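(* Let $a\in[0,1)$, let $v=\{v_n\}_{n=1}^\infty$ be a complex sequence and $V=\mathrm{diag}(v_1,v_2,\dots)$. Let $K'$ be the semi-infinite matrix with entries \[ K'_{m,n}:=\sqrt{|v_m|}\Big[\frac{a}{1-a}+\min(m,n)\Big]\sqrt{|v_n|},\qquad m,n\in\mathbb{N}. \] If $K'$, regarded as an operator on $\ell^2(\mathbb{N})$, satisfies $\|K'\|<1$, then $\sigma(J_a+V)=\sigma_{\mathrm c}(J_a+V)=\sigma(J_a)$. Equivalently (the two conditions being equivalent), if there is a constant $c<1$ such that $|V|\le c(-\Delta_a)$ in the sense of quadratic forms, then $\sigma(J_a+V)=\sigma_{\mathrm c}(J_a+V)=\sigma(J_a)$.
   Context: $\mathbb{N}=\{1,2,\dots\}$. For $a\in\mathbb{C}$, $J_a$ is the operator on $\ell^2(\mathbb{N})$ with $(J_a\psi)_1=a\psi_1+\psi_2$ and $(J_a\psi)_n=\psi_{n-1}+\psi_{n+1}$ for $n\ge2$; for $a\in[0,1)$ one has $\sigma(J_a)=[-2,2]$. $-\Delta_a:=2-J_a$. $|V|=\mathrm{diag}(|v_1|,|v_2|,\dots)$. $\sigma_{\mathrm c}$ denotes the continuous spectrum. *)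

theory Defs
  imports "HOL-Analysis.Analysis"
begin

text \<open>Sequences on \<open>\<nat> = {1,2,...}\<close> are modelled as functions \<open>nat \<Rightarrow> complex\<close>;
  index 0 is unused (elements of l2 vanish at 0).\<close>

definition l2 :: "(nat \<Rightarrow> complex) set" where
  "l2 = {\<psi>. \<psi> 0 = 0 \<and> summable (\<lambda>n. (cmod (\<psi> n))\<^sup>2)}"

definition l2norm :: "(nat \<Rightarrow> complex) \<Rightarrow> real" where
  "l2norm \<psi> = sqrt (\<Sum>n. (cmod (\<psi> n))\<^sup>2)"

definition Jac :: "real \<Rightarrow> (nat \<Rightarrow> complex) \<Rightarrow> (nat \<Rightarrow> complex)" where
  "Jac a \<psi> n = (if n = 0 then 0
                 else if n = 1 then complex_of_real a * \<psi> 1 + \<psi> 2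
                 else \<psi> (n - 1) + \<psi> (n + 1))"

definition multop :: "(nat \<Rightarrow> complex) \<Rightarrow> (nat \<Rightarrow> complex) \<Rightarrow> (nat \<Rightarrow> complex)" where
  "multop v \<psi> n = (if n = 0 then 0 else v n * \<psi> n)"

definition JV_dom :: "(nat \<Rightarrow> complex) \<Rightarrow> (nat \<Rightarrow> complex) set" where
  "JV_dom v = {\<psi> \<in> l2. multop v \<psi> \<in> l2}"

definition JV :: "real \<Rightarrow> (nat \<Rightarrow> complex) \<Rightarrow> (nat \<Rightarrow> complex) \<Rightarrow> (nat \<Rightarrow> complex)" where
  "JV a v \<psi> = (\<lambda>n. Jac a \<psi> n + multop v \<psi> n)"

definition shifted :: "((nat \<Rightarrow> complex) \<Rightarrow> (nat \<Rightarrow> complex)) \<Rightarrow> complex \<Rightarrow> (nat \<Rightarrow> complex) \<Rightarrow> (nat \<Rightarrow> complex)" where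
  "shifted T z \<psi> = (\<lambda>n. T \<psi> n - z * \<psi> n)"

definition in_resolvent :: "(nat \<Rightarrow> complex) set \<Rightarrow> ((nat \<Rightarrow> complex) \<Rightarrow> (nat \<Rightarrow> complex)) \<Rightarrow> complex \<Rightarrow> bool" where
  "in_resolvent D T z \<longleftrightarrow> bij_betw (shifted T z) D l2 \<and>
      (\<exists>C. \<forall>\<psi>\<in>D. l2norm \<psi> \<le> C * l2norm (shifted T z \<psi>))"

definition op_spectrum :: "(nat \<Rightarrow> complex) set \<Rightarrow> ((nat \<Rightarrow> complex) \<Rightarrow> (nat \<Rightarrow> complex)) \<Rightarrow> complex set" where
  "op_spectrum D T = {z. \<not> in_resolvent D T z}"

text \<open>Continuous spectrum: spectral points where \<open>T - z\<close> is injective with dense range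
  (so \<open>\<sigma> = \<sigma>_p \<union> \<sigma>_r \<union> \<sigma>_c\<close> disjointly).\<close>
definition op_cspectrum :: "(nat \<Rightarrow> complex) set \<Rightarrow> ((nat \<Rightarrow> complex) \<Rightarrow> (nat \<Rightarrow> complex)) \<Rightarrow> complex set" where
  "op_cspectrum D T = {z \<in> op_spectrum D T. inj_on (shifted T z) D \<and>
      (\<forall>\<phi>\<in>l2. \<forall>\<epsilon>>0. \<exists>\<psi>\<in>D. l2norm (\<lambda>n. shifted T z \<psi> n - \<phi> n) < \<epsilon>)}"

definition Kmat :: "real \<Rightarrow> (nat \<Rightarrow> complex) \<Rightarrow> nat \<Rightarrow> nat \<Rightarrow> real" where
  "Kmat a v m n = sqrt (cmod (v m)) * (a / (1 - a) + real (min m n)) * sqrt (cmod (v n))"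

text \<open>A semi-infinite matrix (indices \<open>\<ge> 1\<close>) defines an operator on \<open>\<ell>\<^sup>2(\<nat>)\<close> of norm \<open>\<le> c\<close>:
  tested on finitely supported vectors, all truncations of \<open>K\<psi>\<close> have norm \<open>\<le> c\<parallel>\<psi>\<parallel>\<close>.\<close>
definition matrix_norm_le :: "(nat \<Rightarrow> nat \<Rightarrow> real) \<Rightarrow> real \<Rightarrow> bool" where
  "matrix_norm_le K c \<longleftrightarrow> (\<forall>N M (\<psi>::nat \<Rightarrow> complex).
      (\<Sum>m=1..M. (cmod (\<Sum>n=1..N. complex_of_real (K m n) * \<psi> n))\<^sup>2)
        \<le> c\<^sup>2 * (\<Sum>n=1..N. (cmod (\<psi> n))\<^sup>2))"

definition matrix_norm_lt1 :: "(nat \<Rightarrow> nat \<Rightarrow> real) \<Rightarrow> bool" where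
  "matrix_norm_lt1 K \<longleftrightarrow> (\<exists>c. 0 \<le> c \<and> c < 1 \<and> matrix_norm_le K c)"

definition negLap_form :: "real \<Rightarrow> (nat \<Rightarrow> complex) \<Rightarrow> real" where
  "negLap_form a \<psi> = Re (\<Sum>n. cnj (\<psi> n) * (2 * \<psi> n - Jac a \<psi> n))"

definition form_bounded :: "real \<Rightarrow> (nat \<Rightarrow> complex) \<Rightarrow> real \<Rightarrow> bool" where
  "form_bounded a v c \<longleftrightarrow> (\<forall>\<psi>\<in>l2. summable (\<lambda>n. cmod (v n) * (cmod (\<psi> n))\<^sup>2) \<and>
      (\<Sum>n. cmod (v n) * (cmod (\<psi> n))\<^sup>2) \<le> c * negLap_form a \<psi>)"

end

theory Submission
  imports Defs
begin

text \<open>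
  Write \<open>z = k + 1/k\<close> with \<open>|k| \<le> 1\<close>. The Green function \<open>G\<^sub>z(m,n)\<close> of \<open>J\<^sub>a\<close> is dominated entrywise by its
  value \<open>a/(1-a) + min m n\<close> at the edge \<open>z = 2\<close>. Thus \<open>(z - J\<^sub>a) x = V y\<close> implies
  \<open>\<parallel>|V|\<^sup>1\<^sup>/\<^sup>2 x\<parallel> \<le> \<parallel>K'\<parallel> \<parallel>|V|\<^sup>1\<^sup>/\<^sup>2 y\<parallel>\<close> for every complex \<open>z\<close>, so \<open>J\<^sub>a + V\<close> has no eigenvalues at all. The
  adjoint \<open>J\<^sub>a + cnj V\<close> satisfies the same hypothesis, so all ranges are dense and there is no residual
  spectrum. Off \<open>[-2,2]\<close> the same estimate shows that \<open>J\<^sub>a + V - z\<close> is bounded below; on \<open>[-2,2]\<close> the bound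
  \<open>|v n| \<le> 1/n\<close>, read off the diagonal of \<open>K'\<close>, lets plane waves supported far out serve as a Weyl sequence.

  The two hypotheses agree because \<open>K' = |V|\<^sup>1\<^sup>/\<^sup>2 S S\<^sup>* |V|\<^sup>1\<^sup>/\<^sup>2\<close>, where \<open>S\<close> (weighted summation) inverts the
  difference operator \<open>D\<close> with \<open>-\<Delta>\<^sub>a = D\<^sup>* D\<close>.
\<close>

section \<open>The Hilbert space of square-summable sequences\<close>

lemma l2_zero_index: "\<psi> \<in> l2 \<Longrightarrow> \<psi> 0 = 0"
  by (simp add: l2_def)

lemma l2_summable: "\<psi> \<in> l2 \<Longrightarrow> summable (\<lambda>n. (cmod (\<psi> n))\<^sup>2)"
  by (simp add: l2_def)

lemma l2_comparison:
  assumes "\<psi> 0 = 0" and "summable g" and "\<And>n. (cmod (\<psi> n))\<^sup>2 \<le> g n"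
  shows "\<psi> \<in> l2"
  using assms unfolding l2_def
  by (auto intro!: summable_comparison_test'[of g 0])

lemma l2_add:
  assumes "\<psi> \<in> l2" and "\<phi> \<in> l2"
  shows "(\<lambda>n. \<psi> n + \<phi> n) \<in> l2"
proof (rule l2_comparison)
  show "summable (\<lambda>n. 2 * (cmod (\<psi> n))\<^sup>2 + 2 * (cmod (\<phi> n))\<^sup>2)"
    using assms by (intro summable_add summable_mult l2_summable)
  show "(cmod (\<psi> n + \<phi> n))\<^sup>2 \<le> 2 * (cmod (\<psi> n))\<^sup>2 + 2 * (cmod (\<phi> n))\<^sup>2" for n
  proof -
    have "(cmod (\<psi> n + \<phi> n))\<^sup>2 \<le> (cmod (\<psi> n) + cmod (\<phi> n))\<^sup>2"
      by (intro power_mono norm_triangle_ineq) auto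
    also have "\<dots> \<le> 2 * (cmod (\<psi> n))\<^sup>2 + 2 * (cmod (\<phi> n))\<^sup>2"
      using sum_squares_bound[of "cmod (\<psi> n)" "cmod (\<phi> n)"] by (simp add: power2_sum)
    finally show ?thesis .
  qed
qed (use assms in \<open>simp add: l2_zero_index\<close>)

lemma l2_mult_bounded:
  assumes "bounded (range w)" and "\<psi> \<in> l2"
  shows "(\<lambda>n. w n * \<psi> n) \<in> l2"
proof -
  obtain B where B: "\<And>n. cmod (w n) \<le> B"
    using assms(1) by (auto simp: bounded_iff)
  show ?thesis
  proof (rule l2_comparison)
    show "summable (\<lambda>n. B\<^sup>2 * (cmod (\<psi> n))\<^sup>2)"
      using assms by (intro summable_mult l2_summable)
    show "(cmod (w n * \<psi> n))\<^sup>2 \<le> B\<^sup>2 * (cmod (\<psi> n))\<^sup>2" for n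
      using B[of n] by (simp add: norm_mult power_mult_distrib mult_right_mono power_mono)
  qed (use assms in \<open>simp add: l2_zero_index\<close>)
qed

lemma l2_cmult: "\<psi> \<in> l2 \<Longrightarrow> (\<lambda>n. c * \<psi> n) \<in> l2"
  using l2_mult_bounded[of "\<lambda>_. c"] by simp

lemma l2_uminus: "\<psi> \<in> l2 \<Longrightarrow> (\<lambda>n. - \<psi> n) \<in> l2"
  using l2_cmult[of _ "-1"] by simp

lemma l2_diff: "\<psi> \<in> l2 \<Longrightarrow> \<phi> \<in> l2 \<Longrightarrow> (\<lambda>n. \<psi> n - \<phi> n) \<in> l2"
  using l2_add[OF _ l2_uminus] by simp

lemma l2_mult_summable:
  assumes "\<psi> \<in> l2" and "\<phi> \<in> l2"
  shows "summable (\<lambda>n. cmod (\<psi> n) * cmod (\<phi> n))"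
proof (rule summable_comparison_test'[of "\<lambda>n. (cmod (\<psi> n))\<^sup>2 + (cmod (\<phi> n))\<^sup>2" 0])
  show "norm (cmod (\<psi> n) * cmod (\<phi> n)) \<le> (cmod (\<psi> n))\<^sup>2 + (cmod (\<phi> n))\<^sup>2" for n
    using sum_squares_bound[of "cmod (\<psi> n)" "cmod (\<phi> n)"]
      mult_nonneg_nonneg[of "cmod (\<psi> n)" "cmod (\<phi> n)"] by (simp del: mult_nonneg_nonneg)
qed (use assms in \<open>intro summable_add l2_summable\<close>)

lemma l2_inner_summable:
  assumes "\<psi> \<in> l2" and "\<phi> \<in> l2"
  shows "summable (\<lambda>n. \<psi> n \<bullet> \<phi> n)"
  by (rule summable_comparison_test'[OF l2_mult_summable[OF assms], of 0])
     (simp add: Cauchy_Schwarz_ineq2)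

section \<open>Square-summable sequences as a complete real inner product space\<close>

typedef ell = l2 morphisms ell_nth Abs_ell
  by (rule exI[of _ "\<lambda>_. 0"]) (simp add: l2_def)

setup_lifting type_definition_ell

lemma ell_nth_l2 [simp]: "ell_nth x \<in> l2"
  by (rule ell_nth)

lemma ell_nth_0 [simp]: "ell_nth x 0 = 0"
  by (simp add: l2_zero_index)

lemma ell_eqI: "(\<And>n. n > 0 \<Longrightarrow> ell_nth x n = ell_nth y n) \<Longrightarrow> x = y"
  by (metis ell_nth_0 ell_nth_inject ext gr0I)

instantiation ell :: real_vector
begin

lift_definition zero_ell :: ell is "\<lambda>_. 0" by (simp add: l2_def)
lift_definition plus_ell :: "ell \<Rightarrow> ell \<Rightarrow> ell" is "\<lambda>x y n. x n + y n" by (rule l2_add)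
lift_definition minus_ell :: "ell \<Rightarrow> ell \<Rightarrow> ell" is "\<lambda>x y n. x n - y n" by (rule l2_diff)
lift_definition uminus_ell :: "ell \<Rightarrow> ell" is "\<lambda>x n. - x n" by (rule l2_uminus)
lift_definition scaleR_ell :: "real \<Rightarrow> ell \<Rightarrow> ell" is "\<lambda>r x n. of_real r * x n"
  by (rule l2_cmult)

instance
proof
  fix x y z :: ell and r s :: real
  show "x + y + z = x + (y + z)" "x + y = y + x" "0 + x = x" "- x + x = 0" "x - y = x + - y"
    by (transfer; simp add: fun_eq_iff algebra_simps)+
  show "r *\<^sub>R (x + y) = r *\<^sub>R x + r *\<^sub>R y" "(r + s) *\<^sub>R x = r *\<^sub>R x + s *\<^sub>R x"
    "r *\<^sub>R s *\<^sub>R x = (r * s) *\<^sub>R x" "1 *\<^sub>R x = x"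
    by (transfer; simp add: fun_eq_iff algebra_simps)+
qed

end

instantiation ell :: real_inner
begin

text \<open>This is the real part of the complex inner product. It induces the same norm, so results
  on real Hilbert spaces apply to the complex operators below.\<close>

lift_definition inner_ell :: "ell \<Rightarrow> ell \<Rightarrow> real" is "\<lambda>x y. \<Sum>n. x n \<bullet> y n" .
definition norm_ell :: "ell \<Rightarrow> real" where "norm_ell x = sqrt (x \<bullet> x)"
definition sgn_ell :: "ell \<Rightarrow> ell" where "sgn_ell x = x /\<^sub>R norm x"
definition dist_ell :: "ell \<Rightarrow> ell \<Rightarrow> real" where "dist_ell x y = norm (x - y)"
definition uniformity_ell :: "(ell \<times> ell) filter"
  where "uniformity_ell = (INF e\<in>{0<..}. principal {(x, y). dist x y < e})"
definition open_ell :: "ell set \<Rightarrow> bool"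
  where "open_ell U \<longleftrightarrow> (\<forall>x\<in>U. eventually (\<lambda>(x', y). x' = x \<longrightarrow> y \<in> U) uniformity)"

instance
proof
  fix x y z :: ell and r :: real
  show "x \<bullet> y = y \<bullet> x"
    by transfer (simp add: inner_commute)
  show "(x + y) \<bullet> z = x \<bullet> z + y \<bullet> z"
    by transfer (simp add: inner_add_left suminf_add l2_inner_summable)
  show "(r *\<^sub>R x) \<bullet> y = r * (x \<bullet> y)"
  proof transfer
    fix r :: real and x y :: "nat \<Rightarrow> complex"
    assume "x \<in> l2" "y \<in> l2"
    then show "(\<Sum>n. (of_real r * x n) \<bullet> y n) = r * (\<Sum>n. x n \<bullet> y n)"
      by (subst suminf_mult[symmetric, OF l2_inner_summable])
         (simp_all add: scaleR_conv_of_real[symmetric])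
  qed
  show "0 \<le> x \<bullet> x"
    by transfer (simp add: l2_inner_summable suminf_nonneg)
  show "x \<bullet> x = 0 \<longleftrightarrow> x = 0"
    by transfer (auto simp: l2_inner_summable suminf_eq_zero_iff fun_eq_iff)
qed (simp_all add: norm_ell_def sgn_ell_def dist_ell_def uniformity_ell_def open_ell_def)

end

lemma ell_nth_zero [simp]: "ell_nth 0 n = 0" by transfer simp
lemma ell_nth_add [simp]: "ell_nth (x + y) n = ell_nth x n + ell_nth y n" by transfer simp
lemma ell_nth_diff [simp]: "ell_nth (x - y) n = ell_nth x n - ell_nth y n" by transfer simp
lemma ell_nth_uminus [simp]: "ell_nth (- x) n = - ell_nth x n" by transfer simp
lemma ell_nth_scaleR [simp]: "ell_nth (r *\<^sub>R x) n = of_real r * ell_nth x n" by transfer simp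

lemma inner_ell_eq: "x \<bullet> y = (\<Sum>n. ell_nth x n \<bullet> ell_nth y n)"
  by transfer simp

lemma norm_ell_power2: "(norm (x :: ell))\<^sup>2 = (\<Sum>n. (cmod (ell_nth x n))\<^sup>2)"
  by (simp add: power2_norm_eq_inner inner_ell_eq)

lemma norm_ell_eq: "norm (x :: ell) = l2norm (ell_nth x)"
  by (simp add: norm_eq_sqrt_inner inner_ell_eq l2norm_def)

lemma sum_le_norm_ell:
  assumes "finite A"
  shows "(\<Sum>n\<in>A. (cmod (ell_nth x n))\<^sup>2) \<le> (norm x)\<^sup>2"
  unfolding norm_ell_power2 by (rule sum_le_suminf) (use assms in \<open>auto simp: l2_summable\<close>)

lemma norm_ell_leI:
  assumes "0 \<le> B" and "\<And>N. (\<Sum>n<N. (cmod (ell_nth x n))\<^sup>2) \<le> B\<^sup>2"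
  shows "norm x \<le> B"
proof -
  have "(norm x)\<^sup>2 \<le> B\<^sup>2"
    unfolding norm_ell_power2 by (rule suminf_le_const) (use assms in \<open>auto simp: l2_summable\<close>)
  then show ?thesis using assms(1) by (rule power2_le_imp_le)
qed

lemma cmod_ell_nth_le: "cmod (ell_nth x n) \<le> norm x"
  by (rule power2_le_imp_le) (use sum_le_norm_ell[of "{n}" x] in simp_all)

lemma ell_nth_tendsto_0: "(\<lambda>n. ell_nth x n) \<longlonglongrightarrow> 0"
proof -
  have "(\<lambda>n. sqrt ((cmod (ell_nth x n))\<^sup>2)) \<longlonglongrightarrow> sqrt 0"
    by (intro tendsto_real_sqrt summable_LIMSEQ_zero l2_summable ell_nth_l2)
  then show ?thesis by (simp add: tendsto_norm_zero_iff)
qed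

text \<open>A Cauchy sequence converges in each coordinate. The Cauchy estimate for finite partial
  sums survives the limit in the second index, uniformly in the length N of the sum, which gives
  both membership of the limit in \<open>l2\<close> and convergence in norm.\<close>

instance ell :: complete_space
proof
  fix X :: "nat \<Rightarrow> ell"
  assume X: "Cauchy X"
  have "Cauchy (\<lambda>i. ell_nth (X i) n)" for n
  proof (rule metric_CauchyI)
    fix e :: real assume "e > 0"
    then obtain M where M: "\<And>i j. i \<ge> M \<Longrightarrow> j \<ge> M \<Longrightarrow> dist (X i) (X j) < e"
      using X by (meson metric_CauchyD)
    have "dist (ell_nth (X i) n) (ell_nth (X j) n) \<le> dist (X i) (X j)" for i j
      using cmod_ell_nth_le[of "X i - X j" n] by (simp add: dist_norm)
    with M show "\<exists>M. \<forall>i\<ge>M. \<forall>j\<ge>M. dist (ell_nth (X i) n) (ell_nth (X j) n) < e"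
      by (meson le_less_trans)
  qed
  then have "\<forall>n. \<exists>l. (\<lambda>i. ell_nth (X i) n) \<longlonglongrightarrow> l"
    by (simp add: Cauchy_convergent_iff convergent_def)
  then obtain l where l: "\<And>n. (\<lambda>i. ell_nth (X i) n) \<longlonglongrightarrow> l n"
    by metis
  have bound: "\<exists>M. \<forall>i\<ge>M. \<forall>N. (\<Sum>n<N. (cmod (ell_nth (X i) n - l n))\<^sup>2) \<le> e\<^sup>2" if "e > 0" for e
  proof -
    obtain M where M: "\<And>i j. i \<ge> M \<Longrightarrow> j \<ge> M \<Longrightarrow> dist (X i) (X j) < e"
      using X \<open>e > 0\<close> by (meson metric_CauchyD)
    have "(\<Sum>n<N. (cmod (ell_nth (X i) n - l n))\<^sup>2) \<le> e\<^sup>2" if "i \<ge> M" for i N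
    proof (rule LIMSEQ_le_const2)
      show "(\<lambda>j. \<Sum>n<N. (cmod (ell_nth (X i) n - ell_nth (X j) n))\<^sup>2)
          \<longlonglongrightarrow> (\<Sum>n<N. (cmod (ell_nth (X i) n - l n))\<^sup>2)"
        by (intro tendsto_intros l)
      show "\<exists>K. \<forall>j\<ge>K. (\<Sum>n<N. (cmod (ell_nth (X i) n - ell_nth (X j) n))\<^sup>2) \<le> e\<^sup>2"
      proof (intro exI allI impI)
        fix j assume "j \<ge> M"
        have "(\<Sum>n<N. (cmod (ell_nth (X i) n - ell_nth (X j) n))\<^sup>2) \<le> (norm (X i - X j))\<^sup>2"
          using sum_le_norm_ell[of "{..<N}" "X i - X j"] by simp
        also have "\<dots> \<le> e\<^sup>2"
          using M[OF \<open>i \<ge> M\<close> \<open>j \<ge> M\<close>] by (intro power_mono) (auto simp: dist_norm)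
        finally show "(\<Sum>n<N. (cmod (ell_nth (X i) n - ell_nth (X j) n))\<^sup>2) \<le> e\<^sup>2" .
      qed
    qed
    then show ?thesis by blast
  qed
  have l0: "l 0 = 0"
    using l[of 0] by (simp add: LIMSEQ_const_iff)
  have "l \<in> l2"
  proof -
    obtain M where M: "\<And>N. (\<Sum>n<N. (cmod (ell_nth (X M) n - l n))\<^sup>2) \<le> 1\<^sup>2"
      using bound[of 1] by auto
    have "summable (\<lambda>n. (cmod (ell_nth (X M) n - l n))\<^sup>2)"
      by (rule bounded_imp_summable[of _ 1]) (use M in \<open>simp_all add: lessThan_Suc_atMost[symmetric] del: sum.lessThan_Suc\<close>)
    then have "(\<lambda>n. ell_nth (X M) n - l n) \<in> l2"
      by (simp add: l2_def l0)
    from l2_diff[OF ell_nth_l2[of "X M"] this] show ?thesis by simp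
  qed
  then have nth_l: "ell_nth (Abs_ell l) = l"
    by (rule Abs_ell_inverse)
  have "X \<longlonglongrightarrow> Abs_ell l"
  proof (rule metric_LIMSEQ_I)
    fix e :: real assume e: "e > 0"
    then obtain M where M: "\<And>i N. i \<ge> M \<Longrightarrow> (\<Sum>n<N. (cmod (ell_nth (X i) n - l n))\<^sup>2) \<le> (e/2)\<^sup>2"
      using bound[of "e/2"] by auto
    have "dist (X i) (Abs_ell l) < e" if "i \<ge> M" for i
    proof -
      have "norm (X i - Abs_ell l) \<le> e/2"
        by (rule norm_ell_leI) (use M[OF that] e in \<open>auto simp: nth_l\<close>)
      with e show ?thesis by (simp add: dist_norm)
    qed
    then show "\<exists>no. \<forall>n\<ge>no. dist (X n) (Abs_ell l) < e" by blast
  qed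
  then show "convergent X" by (auto simp: convergent_def)
qed

section \<open>Dense and surjective operators on real Hilbert spaces\<close>

text \<open>By convexity the midpoint of two points of S is again at distance at least d from x, so
  the parallelogram law makes every minimising sequence Cauchy.\<close>

lemma nearest_point_exists:
  fixes S :: "'a::{real_inner, complete_space} set"
  assumes "closed S" and "convex S" and "S \<noteq> {}"
  obtains p where "p \<in> S" and "\<And>q. q \<in> S \<Longrightarrow> norm (x - p) \<le> norm (x - q)"
proof -
  define d where "d = infdist x S"
  have d_le: "d \<le> norm (x - q)" if "q \<in> S" for q
    using infdist_le[OF that] by (simp add: d_def dist_norm)
  have d0: "d \<ge> 0" by (simp add: d_def infdist_nonneg)
  have "\<exists>q\<in>S. norm (x - q) < d + inverse (real (Suc i))" for i
    using cInf_lessD[of "dist x ` S" "d + inverse (real (Suc i))"] assms(3)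
    by (auto simp: d_def infdist_notempty dist_norm)
  then obtain X where XS: "\<And>i. X i \<in> S" and X: "\<And>i. norm (x - X i) < d + inverse (real (Suc i))"
    by metis
  have lim: "(\<lambda>i. norm (x - X i)) \<longlonglongrightarrow> d"
  proof (rule tendsto_sandwich[of "\<lambda>_. d" _ _ "\<lambda>i. d + inverse (real (Suc i))"])
    show "(\<lambda>i. d + inverse (real (Suc i))) \<longlonglongrightarrow> d"
      using tendsto_add[OF tendsto_const LIMSEQ_inverse_real_of_nat, of d] by simp
  qed (use d_le XS less_imp_le[OF X] in \<open>auto intro!: always_eventually simp del: of_nat_Suc\<close>)
  have par: "(norm (p - q))\<^sup>2 \<le> 2 * ((norm (x - p))\<^sup>2 - d\<^sup>2) + 2 * ((norm (x - q))\<^sup>2 - d\<^sup>2)"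
    if "p \<in> S" "q \<in> S" for p q
  proof -
    have "(1/2) *\<^sub>R p + (1/2) *\<^sub>R q \<in> S"
      using convexD[OF assms(2) that, of "1/2" "1/2"] by simp
    then have "d\<^sup>2 \<le> (norm (x - ((1/2) *\<^sub>R p + (1/2) *\<^sub>R q)))\<^sup>2"
      using d_le d0 by (intro power_mono) auto
    also have "x - ((1/2) *\<^sub>R p + (1/2) *\<^sub>R q) = (1/2) *\<^sub>R ((x - p) + (x - q))"
      by (simp add: scaleR_right_distrib scaleR_right_diff_distrib flip: scaleR_left_distrib)
    finally have "4 * d\<^sup>2 \<le> (norm ((x - p) + (x - q)))\<^sup>2"
      by (simp add: power_mult_distrib power_divide)
    moreover have "(norm ((x - p) + (x - q)))\<^sup>2 + (norm ((x - q) - (x - p)))\<^sup>2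
        = 2 * (norm (x - p))\<^sup>2 + 2 * (norm (x - q))\<^sup>2"
      unfolding power2_norm_eq_inner inner_add inner_diff[of "x - q" "x - p"] inner_diff_right[of _ "x - q" "x - p"]
      by (simp add: inner_commute)
    ultimately show ?thesis by simp
  qed
  have "Cauchy X"
  proof (rule metric_CauchyI)
    fix e :: real assume e: "e > 0"
    have "(\<lambda>i. (norm (x - X i))\<^sup>2 - d\<^sup>2) \<longlonglongrightarrow> d\<^sup>2 - d\<^sup>2"
      by (intro tendsto_intros lim)
    then have "eventually (\<lambda>i. (norm (x - X i))\<^sup>2 - d\<^sup>2 < e\<^sup>2 / 4) sequentially"
      by (rule order_tendstoD(2)) (use e in simp)
    then obtain M where M: "\<And>i. i \<ge> M \<Longrightarrow> (norm (x - X i))\<^sup>2 - d\<^sup>2 < e\<^sup>2 / 4"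
      by (auto simp: eventually_sequentially)
    have "dist (X i) (X j) < e" if "i \<ge> M" "j \<ge> M" for i j
    proof -
      have "(norm (X i - X j))\<^sup>2 < e\<^sup>2"
        using par[OF XS[of i] XS[of j]] M[OF that(1)] M[OF that(2)] by (simp add: field_simps)
      then show ?thesis using e by (simp add: dist_norm power2_less_imp_less)
    qed
    then show "\<exists>M. \<forall>i\<ge>M. \<forall>j\<ge>M. dist (X i) (X j) < e" by blast
  qed
  then obtain p where p: "X \<longlonglongrightarrow> p"
    by (metis Cauchy_convergent_iff convergent_def)
  show thesis
  proof (rule that[of p])
    show "p \<in> S" using assms(1) XS p by (rule closed_sequentially)
    have "(\<lambda>i. norm (x - X i)) \<longlonglongrightarrow> norm (x - p)"
      by (intro tendsto_intros p)
    with lim have "norm (x - p) = d" by (metis LIMSEQ_unique)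
    then show "norm (x - p) \<le> norm (x - q)" if "q \<in> S" for q
      using d_le[OF that] by simp
  qed
qed

lemma subspace_closure:
  fixes S :: "'a::real_normed_vector set"
  assumes "subspace S"
  shows "subspace (closure S)"
proof (rule subspaceI)
  show "0 \<in> closure S"
    using assms closure_subset subspace_0 by blast
next
  fix x y assume "x \<in> closure S" "y \<in> closure S"
  then obtain X Y where "\<And>n. X n \<in> S" "X \<longlonglongrightarrow> x" "\<And>n. Y n \<in> S" "Y \<longlonglongrightarrow> y"
    unfolding closure_sequential by blast
  then show "x + y \<in> closure S"
    unfolding closure_sequential
    by (intro exI[of _ "\<lambda>n. X n + Y n"]) (auto intro: tendsto_add subspace_add[OF assms])
next
  fix x and c :: real assume "x \<in> closure S"
  then obtain X where "\<And>n. X n \<in> S" "X \<longlonglongrightarrow> x"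
    unfolding closure_sequential by blast
  then show "c *\<^sub>R x \<in> closure S"
    unfolding closure_sequential
    by (intro exI[of _ "\<lambda>n. c *\<^sub>R X n"])
       (auto intro: tendsto_scaleR tendsto_const subspace_scale[OF assms])
qed

text \<open>For p nearest to y in the closed range, the residual y - p is orthogonal to the range,
  and the hypothesis makes it vanish. The hypothesis expresses injectivity of the adjoint without
  requiring an adjoint operator.\<close>

lemma dense_range_if_adjoint_injective:
  fixes f :: "'a::real_vector \<Rightarrow> 'b::{real_inner, complete_space}"
  assumes "linear f" and "\<And>y. (\<And>x. f x \<bullet> y = 0) \<Longrightarrow> y = 0"
  shows "closure (range f) = UNIV"
proof -
  have sub: "subspace (closure (range f))"
    by (intro subspace_closure linear_subspace_image assms(1) subspace_UNIV)
  have "y \<in> closure (range f)" for y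
  proof -
    obtain p where p: "p \<in> closure (range f)"
      and min: "\<And>q. q \<in> closure (range f) \<Longrightarrow> norm (y - p) \<le> norm (y - q)"
      using nearest_point_exists[of "closure (range f)" y] subspace_imp_convex[OF sub]
      by auto
    have "f x \<bullet> (y - p) = 0" for x
    proof (rule ccontr)
      assume ne: "f x \<bullet> (y - p) \<noteq> 0"
      define w where "w = f x"
      \<comment> \<open>This t minimises the distance from y to the line through p in direction w. A
        nonzero inner product would make the new point strictly closer than p.\<close>
      define t where "t = (w \<bullet> (y - p)) / (w \<bullet> w)"
      have w: "w \<in> closure (range f)" "w \<bullet> (y - p) \<noteq> 0" "w \<bullet> w > 0"
        using ne closure_subset[of "range f"] by (auto simp: w_def)
      have "p + t *\<^sub>R w \<in> closure (range f)"
        using sub p w(1) by (simp add: subspace_add subspace_scale)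
      then have "(norm (y - p))\<^sup>2 \<le> (norm (y - (p + t *\<^sub>R w)))\<^sup>2"
        using min by (intro power_mono) auto
      also have "\<dots> = (norm (y - p))\<^sup>2 - 2 * t * (w \<bullet> (y - p)) + t * t * (w \<bullet> w)"
        by (simp add: power2_norm_eq_inner algebra_simps inner_commute)
      also have "\<dots> = (norm (y - p))\<^sup>2 - (w \<bullet> (y - p))\<^sup>2 / (w \<bullet> w)"
        using w(3) by (simp add: t_def power2_eq_square)
      finally show False using w by (simp add: divide_le_0_iff)
    qed
    then have "y - p = 0" using assms(2) by blast
    with p show ?thesis by simp
  qed
  then show ?thesis by blast
qed

text \<open>The lower bound makes the range complete, hence closed; being dense, it is
  everything.\<close>

lemma surj_if_bounded_below_dense:
  fixes f :: "'a::{real_normed_vector, complete_space} \<Rightarrow> 'b::real_normed_vector"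
  assumes "bounded_linear f" and "\<delta> > 0" and "\<And>x. \<delta> * norm x \<le> norm (f x)"
    and "closure (range f) = UNIV"
  shows "surj f"
proof -
  have "complete (range f)"
    using complete_isometric_image[of \<delta> UNIV f] assms complete_UNIV subspace_UNIV
    by (auto simp: mult.commute)
  then show ?thesis
    using assms(4) closure_closed complete_imp_closed by blast
qed

section \<open>Jacobi operators as bounded operators\<close>

lemma norm_ell_leI':
  assumes "0 \<le> B" and "\<And>N. (\<Sum>n=1..N. (cmod (ell_nth x n))\<^sup>2) \<le> B\<^sup>2"
  shows "norm x \<le> B"
proof (rule norm_ell_leI)
  fix N
  have "(\<Sum>n<N. (cmod (ell_nth x n))\<^sup>2) \<le> (\<Sum>n\<in>{0..N}. (cmod (ell_nth x n))\<^sup>2)"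
    by (rule sum_mono2) auto
  also have "\<dots> = (\<Sum>n=1..N. (cmod (ell_nth x n))\<^sup>2)"
    by (simp add: sum.atLeast_Suc_atMost)
  also have "\<dots> \<le> B\<^sup>2" by (rule assms(2))
  finally show "(\<Sum>n<N. (cmod (ell_nth x n))\<^sup>2) \<le> B\<^sup>2" .
qed (rule assms(1))

lemma norm_ell_mono:
  assumes "\<And>n. n > 0 \<Longrightarrow> cmod (ell_nth x n) \<le> cmod (ell_nth y n)"
  shows "norm x \<le> norm y"
proof (rule norm_ell_leI')
  fix N
  have "(\<Sum>n=1..N. (cmod (ell_nth x n))\<^sup>2) \<le> (\<Sum>n=1..N. (cmod (ell_nth y n))\<^sup>2)"
    using assms by (intro sum_mono power_mono) auto
  also have "\<dots> \<le> (norm y)\<^sup>2" by (rule sum_le_norm_ell) simp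
  finally show "(\<Sum>n=1..N. (cmod (ell_nth x n))\<^sup>2) \<le> (norm y)\<^sup>2" .
qed simp

section \<open>Shifts, diagonal operators and their adjoints\<close>

lift_definition lshift :: "ell \<Rightarrow> ell" is "\<lambda>x n. if n = 0 then 0 else x (Suc n)"
proof (rule l2_comparison)
  fix x assume "x \<in> l2"
  then show "summable (\<lambda>n. (cmod (x (Suc n)))\<^sup>2)"
    by (subst summable_Suc_iff) (rule l2_summable)
qed auto

lift_definition rshift :: "ell \<Rightarrow> ell" is "\<lambda>x n. x (n - 1)"
proof -
  fix x assume x: "x \<in> l2"
  then have "summable (\<lambda>n. (cmod (x (Suc n - 1)))\<^sup>2)"
    by (simp add: l2_summable)
  then have "summable (\<lambda>n. (cmod (x (n - 1)))\<^sup>2)"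
    by (subst (asm) summable_Suc_iff[of "\<lambda>n. (cmod (x (n - 1)))\<^sup>2"])
  then show "(\<lambda>n. x (n - 1)) \<in> l2"
    using x by (simp add: l2_def)
qed

text \<open>The value is meaningful only if the product lies in \<open>l2\<close>; hence the
  assumption \<open>bounded (range w)\<close> in the lemmas about it.\<close>

definition mulop :: "(nat \<Rightarrow> complex) \<Rightarrow> ell \<Rightarrow> ell" where
  "mulop w x = Abs_ell (\<lambda>n. w n * ell_nth x n)"

definition jacobi :: "(nat \<Rightarrow> complex) \<Rightarrow> ell \<Rightarrow> ell" where
  "jacobi w x = lshift x + rshift x + mulop w x"

lemma ell_nth_lshift: "ell_nth (lshift x) n = (if n = 0 then 0 else ell_nth x (Suc n))"
  by transfer simp

lemma ell_nth_rshift: "ell_nth (rshift x) n = ell_nth x (n - 1)"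
  by transfer simp

lemma ell_nth_mulop:
  "bounded (range w) \<Longrightarrow> ell_nth (mulop w x) n = w n * ell_nth x n"
  unfolding mulop_def by (subst Abs_ell_inverse) (simp_all add: l2_mult_bounded)

lemma inner_rshift: "rshift x \<bullet> y = x \<bullet> lshift y"
proof -
  have s: "summable (\<lambda>n. ell_nth (rshift x) n \<bullet> ell_nth y n)"
    by (simp add: l2_inner_summable)
  have "rshift x \<bullet> y = (\<Sum>n. ell_nth (rshift x) (Suc n) \<bullet> ell_nth y (Suc n))"
    using suminf_split_head[OF s] by (simp add: inner_ell_eq)
  also have "\<dots> = x \<bullet> lshift y"
    unfolding inner_ell_eq
    by (rule suminf_cong) (simp add: ell_nth_rshift ell_nth_lshift)
  finally show ?thesis .
qed

lemma inner_lshift: "lshift x \<bullet> y = x \<bullet> rshift y"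
  by (metis inner_commute inner_rshift)

lemma inner_mulop:
  assumes "bounded (range w)"
  shows "mulop w x \<bullet> y = x \<bullet> mulop (\<lambda>n. cnj (w n)) y"
proof -
  have "bounded (range (\<lambda>n. cnj (w n)))"
    using assms by (auto simp: bounded_iff)
  with assms show ?thesis
    by (simp add: inner_ell_eq ell_nth_mulop inner_complex_def algebra_simps)
qed

lemma norm_lshift: "(norm (lshift x))\<^sup>2 = (norm x)\<^sup>2 - (cmod (ell_nth x 1))\<^sup>2"
proof -
  have s: "summable (\<lambda>n. (cmod (ell_nth x n))\<^sup>2)"
    by (simp add: l2_summable)
  have s': "summable (\<lambda>n. (cmod (ell_nth x (Suc n)))\<^sup>2)"
    using s by (subst summable_Suc_iff)
  have "(norm x)\<^sup>2 = (\<Sum>n. (cmod (ell_nth x (Suc n)))\<^sup>2)"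
    using suminf_split_head[OF s] by (simp add: norm_ell_power2)
  also have "\<dots> = (\<Sum>n. (cmod (ell_nth x (Suc (Suc n))))\<^sup>2) + (cmod (ell_nth x 1))\<^sup>2"
    using suminf_split_head[OF s'] by simp
  also have "(\<Sum>n. (cmod (ell_nth x (Suc (Suc n))))\<^sup>2) = (norm (lshift x))\<^sup>2"
    using suminf_split_head[of "\<lambda>n. (cmod (ell_nth (lshift x) n))\<^sup>2"]
    by (simp add: norm_ell_power2 l2_summable) (simp add: ell_nth_lshift)
  finally show ?thesis by simp
qed

lemma norm_lshift_le: "norm (lshift x) \<le> norm x"
  by (rule power2_le_imp_le) (simp_all add: norm_lshift)

lemma norm_rshift: "norm (rshift x) = norm x"
proof -
  have "lshift (rshift x) = x"
    by (rule ell_eqI) (simp add: ell_nth_lshift ell_nth_rshift)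
  then have "rshift x \<bullet> rshift x = x \<bullet> x"
    by (simp add: inner_rshift)
  then show ?thesis by (simp add: norm_eq_sqrt_inner)
qed

lemma norm_mulop_le:
  assumes "\<And>n. n > 0 \<Longrightarrow> cmod (w n) \<le> B" and "bounded (range w)"
  shows "norm (mulop w x) \<le> B * norm x"
proof (rule norm_ell_leI')
  have B: "B \<ge> 0" using assms(1)[of 1] norm_ge_zero[of "w 1"] by linarith
  then show "0 \<le> B * norm x" by simp
  fix N
  have "(\<Sum>n=1..N. (cmod (ell_nth (mulop w x) n))\<^sup>2) \<le> (\<Sum>n=1..N. B\<^sup>2 * (cmod (ell_nth x n))\<^sup>2)"
    using assms by (intro sum_mono) (simp add: ell_nth_mulop norm_mult power_mult_distrib
        mult_right_mono power_mono)
  also have "\<dots> \<le> (B * norm x)\<^sup>2"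
    using sum_le_norm_ell[of "{1..N}" x]
    by (simp add: sum_distrib_left[symmetric] power_mult_distrib mult_left_mono)
  finally show "(\<Sum>n=1..N. (cmod (ell_nth (mulop w x) n))\<^sup>2) \<le> (B * norm x)\<^sup>2" .
qed

lemma bounded_linear_mulop:
  assumes "bounded (range w)"
  shows "bounded_linear (mulop w)"
proof -
  obtain B where "\<And>n. cmod (w n) \<le> B"
    using assms by (auto simp: bounded_iff)
  then show ?thesis
    using norm_mulop_le[OF _ assms, of B] assms
    by (intro bounded_linear_intro[of _ B])
       (auto intro!: ell_eqI simp: ell_nth_mulop algebra_simps)
qed

lemma bounded_linear_jacobi:
  assumes "bounded (range w)"
  shows "bounded_linear (jacobi w)"
proof -
  have "bounded_linear lshift"
    by (rule bounded_linear_intro[of _ 1])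
       (auto intro!: ell_eqI simp: ell_nth_lshift norm_lshift_le)
  moreover have "bounded_linear rshift"
    by (rule bounded_linear_intro[of _ 1])
       (auto intro!: ell_eqI simp: ell_nth_rshift norm_rshift)
  ultimately show ?thesis
    unfolding jacobi_def[abs_def]
    by (intro bounded_linear_add bounded_linear_mulop assms)
qed

lemma inner_jacobi:
  assumes "bounded (range w)"
  shows "jacobi w x \<bullet> y = x \<bullet> jacobi (\<lambda>n. cnj (w n)) y"
  by (simp add: jacobi_def inner_add inner_rshift inner_lshift inner_mulop[OF assms])

text \<open>This is the diagonal of the tridiagonal matrix J_a + V - z, so
  \<open>jacobi (coef a v z)\<close> is that operator and
  \<open>jacobi (coef a (\<lambda>_. 0) z)\<close> is J_a - z.\<close>

definition coef :: "real \<Rightarrow> (nat \<Rightarrow> complex) \<Rightarrow> complex \<Rightarrow> nat \<Rightarrow> complex" where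
  "coef a v z n = v n + (if n = 1 then of_real a else 0) - z"

lemma bounded_coef:
  assumes "bounded (range v)"
  shows "bounded (range (coef a v z))"
proof -
  obtain B where B: "\<And>n. cmod (v n) \<le> B"
    using assms by (auto simp: bounded_iff)
  have "cmod (coef a v z n) \<le> B + \<bar>a\<bar> + cmod z" for n
  proof -
    have "cmod (coef a v z n) \<le> cmod (v n) + cmod (if n = 1 then of_real a else 0) + cmod z"
      unfolding coef_def by (meson add_right_mono norm_triangle_ineq norm_triangle_ineq4 order_trans)
    also have "\<dots> \<le> B + \<bar>a\<bar> + cmod z"
      using B[of n] by (intro add_mono) auto
    finally show ?thesis .
  qed
  then show ?thesis by (auto simp: bounded_iff)
qed

lemma bounded_coef0 [simp]: "bounded (range (coef a (\<lambda>_. 0) z))"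
  by (rule bounded_coef) simp

lemma coef_cnj: "(\<lambda>n. cnj (coef a v z n)) = coef a (\<lambda>n. cnj (v n)) (cnj z)"
  by (auto simp: coef_def)

lemma ell_nth_jacobi:
  assumes "bounded (range v)"
  shows "ell_nth (jacobi (coef a v z) x) = shifted (JV a v) z (ell_nth x)"
proof
  fix n :: nat
  consider "n = 0" | "n = 1" | "n > 1" by linarith
  then show "ell_nth (jacobi (coef a v z) x) n = shifted (JV a v) z (ell_nth x) n"
    unfolding jacobi_def ell_nth_add ell_nth_mulop[OF bounded_coef[OF assms]]
    by cases (auto simp: ell_nth_lshift ell_nth_rshift shifted_def JV_def Jac_def multop_def coef_def
        algebra_simps numeral_2_eq_2)
qed

lemma jacobi_coef_split:
  assumes "bounded (range v)"
  shows "jacobi (coef a v z) x = jacobi (coef a (\<lambda>_. 0) z) x + mulop v x"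
  by (rule ell_eqI)
     (simp add: jacobi_def ell_nth_mulop bounded_coef[OF assms] assms, simp add: coef_def algebra_simps)

section \<open>The free operator\<close>

text \<open>Completing squares shows that 2 - J_a and 2 + J_a are nonnegative for 0 <= a < 1, which
  confines the free spectrum to [-2,2]. The boundary terms appear because \<open>lshift\<close>
  loses the first coordinate.\<close>

lemma two_minus_jacobi_form:
  "2 * (norm x)\<^sup>2 - jacobi (coef a (\<lambda>_. 0) 0) x \<bullet> x
     = (norm (x - lshift x))\<^sup>2 + (1 - a) * (cmod (ell_nth x 1))\<^sup>2"
  and two_plus_jacobi_form:
  "2 * (norm x)\<^sup>2 + jacobi (coef a (\<lambda>_. 0) 0) x \<bullet> x
     = (norm (x + lshift x))\<^sup>2 + (1 + a) * (cmod (ell_nth x 1))\<^sup>2"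
proof -
  have "mulop (coef a (\<lambda>_. 0) 0) x \<bullet> x = (\<Sum>n\<in>{1}. a * (cmod (ell_nth x n))\<^sup>2)"
    unfolding inner_ell_eq
    by (subst suminf_finite[of "{1}"])
       (auto simp: ell_nth_mulop, auto simp: coef_def power2_norm_eq_inner simp flip: scaleR_conv_of_real)
  then have J: "jacobi (coef a (\<lambda>_. 0) 0) x \<bullet> x = 2 * (x \<bullet> lshift x) + a * (cmod (ell_nth x 1))\<^sup>2"
    by (simp add: jacobi_def inner_add inner_rshift inner_lshift) (metis inner_commute inner_rshift)
  have L: "lshift x \<bullet> lshift x = x \<bullet> x - (cmod (ell_nth x 1))\<^sup>2"
    using norm_lshift[of x] by (simp add: power2_norm_eq_inner)
  show "2 * (norm x)\<^sup>2 - jacobi (coef a (\<lambda>_. 0) 0) x \<bullet> x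
     = (norm (x - lshift x))\<^sup>2 + (1 - a) * (cmod (ell_nth x 1))\<^sup>2"
    unfolding J power2_norm_eq_inner[of "x - lshift x"] power2_norm_eq_inner[of x]
    by (simp add: inner_diff L inner_commute[of "lshift x" x] algebra_simps)
  show "2 * (norm x)\<^sup>2 + jacobi (coef a (\<lambda>_. 0) 0) x \<bullet> x
     = (norm (x + lshift x))\<^sup>2 + (1 + a) * (cmod (ell_nth x 1))\<^sup>2"
    unfolding J power2_norm_eq_inner[of "x + lshift x"] power2_norm_eq_inner[of x]
    by (simp add: inner_add L inner_commute[of "lshift x" x] algebra_simps)
qed

text \<open>Pairing (J_a - z) x with a vector no longer than x bounds the norm from below. For
  nonreal z this vector is i x, which isolates the imaginary part of z; for real z it is x, and the
  two forms above apply.\<close>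

lemma free_bounded_below:
  assumes "0 \<le> a" "a < 1" and z: "z \<notin> of_real ` {-2..2}"
  shows "\<exists>\<delta>>0. \<forall>x. \<delta> * norm x \<le> norm (jacobi (coef a (\<lambda>_. 0) z) x)"
proof -
  let ?J = "\<lambda>z. jacobi (coef a (\<lambda>_. 0) z)"
  have form_case: "\<exists>\<delta>>0. \<forall>x. \<delta> * norm x \<le> norm (?J z x)"
    if "\<epsilon> > 0" and form: "\<And>x. \<epsilon> * (norm x)\<^sup>2 \<le> \<bar>?J z x \<bullet> y x\<bar>" and y: "\<And>x. norm (y x) \<le> norm x"
    for \<epsilon> y
  proof (intro exI conjI allI)
    fix x
    have "\<epsilon> * (norm x)\<^sup>2 \<le> norm (?J z x) * norm (y x)"
      using form[of x] Cauchy_Schwarz_ineq2[of "?J z x" "y x"] by linarith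
    also have "\<dots> \<le> norm (?J z x) * norm x"
      by (intro mult_left_mono y) auto
    finally show "\<epsilon> * norm x \<le> norm (?J z x)"
      by (cases "x = 0") (auto simp: power2_eq_square)
  qed (fact that)
  have shift: "?J z x = ?J (of_real (Re z)) x - Im z *\<^sub>R mulop (\<lambda>_. \<i>) x" for z x
    by (rule ell_eqI) (auto simp: jacobi_def ell_nth_mulop, auto simp: coef_def complex_eq_iff algebra_simps)
  have shift_real: "?J (of_real r) x = ?J 0 x - r *\<^sub>R x" for r x
    by (rule ell_eqI) (auto simp: jacobi_def ell_nth_mulop, auto simp: coef_def algebra_simps)
  show ?thesis
  proof (cases "Im z = 0")
    case False
    have nI: "norm (mulop (\<lambda>_. \<i>) x) = norm x" for x
      by (simp add: norm_eq_sqrt_inner inner_mulop) (simp add: inner_ell_eq ell_nth_mulop)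
    \<comment> \<open>The operator with real parameter is symmetric and commutes with multiplication
      by i, which is antisymmetric. The pairing therefore equals its own negative.\<close>
    have zero: "?J (of_real (Re z)) x \<bullet> mulop (\<lambda>_. \<i>) x = 0" (is "?B x \<bullet> ?I x = 0") for x
    proof -
      have "?B x \<bullet> ?I x = x \<bullet> ?B (?I x)"
        by (simp add: inner_jacobi coef_cnj)
      also have "?B (?I x) = ?I (?B x)"
        by (rule ell_eqI) (auto simp: jacobi_def ell_nth_mulop ell_nth_lshift ell_nth_rshift algebra_simps)
      also have "x \<bullet> ?I (?B x) = mulop (\<lambda>_. cnj \<i>) x \<bullet> ?B x"
        by (simp add: inner_mulop)
      also have "mulop (\<lambda>_. cnj \<i>) x = - ?I x"
        by (rule ell_eqI) (simp add: ell_nth_mulop)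
      finally show ?thesis by (simp add: inner_commute)
    qed
    show ?thesis
    proof (rule form_case)
      show "\<bar>Im z\<bar> > 0" using False by simp
      show "\<bar>Im z\<bar> * (norm x)\<^sup>2 \<le> \<bar>?J z x \<bullet> mulop (\<lambda>_. \<i>) x\<bar>" for x
        unfolding shift[of z x]
        by (simp add: inner_diff zero nI abs_mult flip: power2_norm_eq_inner)
    qed (simp add: nI)
  next
    case True
    define r where "r = Re z"
    have zr: "z = of_real r" using True by (simp add: r_def complex_eq_iff)
    with z consider "r > 2" | "r < -2" by fastforce
    then show ?thesis
    proof cases
      case 1
      show ?thesis
      proof (rule form_case[of "r - 2" "\<lambda>x. x"])
        fix x
        have "?J 0 x \<bullet> x \<le> 2 * (norm x)\<^sup>2"
          using two_minus_jacobi_form[of x a] assms by (smt (verit) mult_nonneg_nonneg zero_le_power2)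
        then show "(r - 2) * (norm x)\<^sup>2 \<le> \<bar>?J z x \<bullet> x\<bar>"
          unfolding zr shift_real by (simp add: inner_diff algebra_simps power2_norm_eq_inner)
      qed (use 1 in auto)
    next
      case 2
      show ?thesis
      proof (rule form_case[of "- r - 2" "\<lambda>x. x"])
        fix x
        have "- (?J 0 x \<bullet> x) \<le> 2 * (norm x)\<^sup>2"
          using two_plus_jacobi_form[of x a] assms by (smt (verit) mult_nonneg_nonneg zero_le_power2)
        then show "(- r - 2) * (norm x)\<^sup>2 \<le> \<bar>?J z x \<bullet> x\<bar>"
          unfolding zr shift_real by (simp add: inner_diff algebra_simps power2_norm_eq_inner)
      qed (use 2 in auto)
    qed
  qed
qed

section \<open>The Green function of the free operator\<close>

text \<open>The two roots of k^2 - z k + 1 have product 1, so one of them lies in the closed unit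
  disc.\<close>

lemma joukowski_exists: "\<exists>k. k \<noteq> 0 \<and> cmod k \<le> 1 \<and> z = k + 1 / k"
proof -
  define s where "s = csqrt (z\<^sup>2 - 4)"
  define k1 k2 where "k1 = (z + s) / 2" and "k2 = (z - s) / 2"
  have s: "s\<^sup>2 = z\<^sup>2 - 4" by (simp add: s_def)
  have prod: "k1 * k2 = 1"
    unfolding k1_def k2_def using s by (simp add: power2_eq_square algebra_simps)
  have sum: "k1 + k2 = z" by (simp add: k1_def k2_def field_simps)
  have nz: "k1 \<noteq> 0" "k2 \<noteq> 0" using prod by auto
  have "1 / k1 = k2" "1 / k2 = k1"
    using prod nz by (auto simp: field_simps)
  moreover have "cmod k1 \<le> 1 \<or> cmod k2 \<le> 1"
  proof (rule ccontr)
    assume "\<not> ?thesis"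
    then have "1 * 1 < cmod k1 * cmod k2" by (intro mult_strict_mono) auto
    then show False using arg_cong[OF prod, of cmod] by (simp add: norm_mult)
  qed
  ultimately show ?thesis
    using sum nz by (metis add.commute)
qed

text \<open>\<open>green a k\<close> is the kernel of \<open>(z - J\<^sub>a)\<^sup>-\<^sup>1\<close> for \<open>z = k + 1/k\<close>; the recursion for its diagonal makes the
  bound \<open>a/(1-a) + n\<close> immediate for all \<open>|k| \<le> 1\<close>.\<close>

fun green_diag :: "real \<Rightarrow> complex \<Rightarrow> nat \<Rightarrow> complex" where
  "green_diag a k 0 = of_real a / (1 - of_real a * k)"
| "green_diag a k (Suc n) = k + k\<^sup>2 * green_diag a k n"

definition green :: "real \<Rightarrow> complex \<Rightarrow> nat \<Rightarrow> nat \<Rightarrow> complex" where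
  "green a k m n = k ^ (max m n - min m n) * green_diag a k (min m n)"

lemma one_minus_ak:
  assumes "0 \<le> a" "a < 1" "cmod k \<le> 1"
  shows "1 - a \<le> cmod (1 - of_real a * k)"
proof -
  have "cmod (of_real a * k) \<le> a"
    using assms by (simp add: norm_mult mult_left_le)
  then show ?thesis
    using norm_triangle_ineq2[of 1 "of_real a * k"] by simp
qed

lemma green_diag_bound:
  assumes "0 \<le> a" "a < 1" "cmod k \<le> 1"
  shows "cmod (green_diag a k n) \<le> a / (1 - a) + real n"
proof (induction n)
  case 0
  show ?case
    using assms one_minus_ak[OF assms] by (simp add: norm_divide frac_le)
next
  case (Suc n)
  have "cmod (k\<^sup>2 * green_diag a k n) \<le> 1 * cmod (green_diag a k n)"
    unfolding norm_mult norm_power by (intro mult_right_mono power_le_one) (use assms in auto)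
  then show ?case
    using Suc assms(3) norm_triangle_ineq[of k "k\<^sup>2 * green_diag a k n"] by simp
qed

lemma green_bound:
  assumes "0 \<le> a" "a < 1" "cmod k \<le> 1"
  shows "cmod (green a k m n) \<le> a / (1 - a) + real (min m n)"
proof -
  have "cmod (green a k m n) \<le> 1 * cmod (green_diag a k (min m n))"
    unfolding green_def norm_mult norm_power
    by (intro mult_right_mono power_le_one) (use assms in auto)
  then show ?thesis using green_diag_bound[OF assms, of "min m n"] by linarith
qed

text \<open>Site 0 is fictitious: with this value there, the boundary row of J_a takes the same form
  G (n - 1) + G (n + 1) as all other rows.\<close>

lemma green_boundary:
  assumes "0 \<le> a" "a < 1" "cmod k \<le> 1" "m > 0"
  shows "green a k m 0 = of_real a * green a k m 1"
proof -
  obtain p where m: "m = Suc p" using assms(4) gr0_implies_Suc by blast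
  have "1 - of_real a * k \<noteq> 0"
    using one_minus_ak[OF assms(1-3)] assms(2) by auto
  then have "k * green_diag a k 0 = of_real a * green_diag a k 1"
    by (simp add: field_simps power2_eq_square)
  moreover have "green a k m 0 = k ^ p * (k * green_diag a k 0)"
    "green a k m 1 = k ^ p * green_diag a k 1"
    by (simp_all add: m green_def max_def min_def del: green_diag.simps)
  ultimately show ?thesis by simp
qed

text \<open>Subtracting two consecutive steps of the recursion eliminates the inhomogeneous term k.
  This is the homogeneous equation needed to the left of the diagonal.\<close>

lemma green_diag_recurrence:
  "green_diag a k (Suc (Suc n)) + k\<^sup>2 * green_diag a k n = (1 + k\<^sup>2) * green_diag a k (Suc n)"
  by (simp add: algebra_simps)

text \<open>Right of the diagonal the kernel is geometric in n, left of it
  \<open>green_diag_recurrence\<close> applies, and on the diagonal the recursion of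
  \<open>green_diag\<close> produces the 1.\<close>

lemma green_equation:
  assumes "0 \<le> a" "a < 1" "cmod k \<le> 1" "k \<noteq> 0" "m > 0" "n > 0"
  shows "(k + 1 / k) * green a k m n - green a k m (n - 1) - green a k m (n + 1)
           = (if m = n then 1 else 0)"
proof -
  consider "m = n" | "m < n" | "n < m" by linarith
  then show ?thesis
  proof cases
    case 1
    obtain p where "n = Suc p" using assms(6) gr0_implies_Suc by blast
    with 1 assms(4) show ?thesis
      by (simp add: green_def max_def min_def field_simps power2_eq_square)
  next
    case 2
    then obtain d where n: "n = Suc (m + d)" using less_imp_Suc_add by blast
    have "max m (m + d) = m + d" "min m (m + d) = m" by auto
    with n assms(4) show ?thesis
      by (simp add: green_def max_def min_def field_simps power2_eq_square)
  next
    case 3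
    then obtain d where d: "m = Suc (n + d)" using less_imp_Suc_add by blast
    obtain p where n: "n = Suc p" using assms(6) gr0_implies_Suc by blast
    have "green a k m n = k ^ Suc d * green_diag a k (Suc p)"
      "green a k m (n - 1) = k ^ Suc (Suc d) * green_diag a k p"
      "green a k m (n + 1) = k ^ d * green_diag a k (Suc (Suc p))"
      by (simp_all add: green_def d n max_def min_def)
    moreover have "(k + 1 / k) * (k ^ Suc d * green_diag a k (Suc p))
        = k ^ d * ((1 + k\<^sup>2) * green_diag a k (Suc p))"
      using assms(4) by (simp add: field_simps power2_eq_square)
    ultimately show ?thesis
      using 3 unfolding green_diag_recurrence[symmetric]
      by (simp add: algebra_simps power2_eq_square)
  qed
qed

text \<open>The condition on G 0 cancels the boundary term at the left end; only the two terms at N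
  remain.\<close>

lemma summation_by_parts:
  fixes G x :: "nat \<Rightarrow> complex"
  assumes "G 0 = of_real a * G 1" and "N \<ge> 1"
  shows "(\<Sum>n=1..N. G n * (z * x n - Jac a x n))
    = (\<Sum>n=1..N. (z * G n - G (n - 1) - G (n + 1)) * x n) + G (N + 1) * x N - G N * x (N + 1)"
  using assms(2)
proof (induction N rule: dec_induct)
  case base
  show ?case by (simp add: Jac_def assms(1) algebra_simps numeral_2_eq_2)
next
  case (step N)
  then show ?case by (simp add: Jac_def algebra_simps)
qed

text \<open>The terms at the right end vanish because G is bounded in its second index and x tends
  to 0. No decay of G is used, so the formula also covers |k| = 1, that is z in [-2,2].\<close>

lemma green_representation:
  assumes "0 \<le> a" "a < 1" "cmod k \<le> 1" "k \<noteq> 0" "m > 0"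
  shows "(\<lambda>N. \<Sum>n=1..N. green a k m n * ((k + 1 / k) * ell_nth x n - Jac a (ell_nth x) n))
           \<longlonglongrightarrow> ell_nth x m"
proof -
  let ?G = "green a k m"
  have bdd: "cmod (?G n) \<le> a / (1 - a) + real m" for n
    using green_bound[OF assms(1-3), of m n] by (simp add: min_def split: if_splits)
  have x0: "(\<lambda>N. ell_nth x (N + 1)) \<longlonglongrightarrow> 0"
    using LIMSEQ_ignore_initial_segment[OF ell_nth_tendsto_0, of x 1] by simp
  have 1: "(\<lambda>N. ?G (N + 1) * ell_nth x N) \<longlonglongrightarrow> 0"
    by (rule lim_null_mult_left_bounded[OF always_eventually ell_nth_tendsto_0]) (use bdd in blast)
  have 2: "(\<lambda>N. ?G N * ell_nth x (N + 1)) \<longlonglongrightarrow> 0"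
    by (rule lim_null_mult_left_bounded[OF always_eventually x0]) (use bdd in blast)
  have "(\<lambda>N. ell_nth x m + ?G (N + 1) * ell_nth x N - ?G N * ell_nth x (N + 1)) \<longlonglongrightarrow> ell_nth x m + 0 - 0"
    by (intro tendsto_intros 1 2)
  moreover have "eventually (\<lambda>N. ell_nth x m + ?G (N + 1) * ell_nth x N - ?G N * ell_nth x (N + 1)
      = (\<Sum>n=1..N. ?G n * ((k + 1 / k) * ell_nth x n - Jac a (ell_nth x) n))) sequentially"
  proof (rule eventually_sequentiallyI[of m])
    fix N assume N: "m \<le> N"
    have "(\<Sum>n=1..N. ((k + 1 / k) * ?G n - ?G (n - 1) - ?G (n + 1)) * ell_nth x n)
        = (\<Sum>n=1..N. if m = n then ell_nth x n else 0)"
      by (rule sum.cong) (use assms in \<open>simp_all add: green_equation[OF assms(1-5)] del: One_nat_def\<close>)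
    also have "\<dots> = ell_nth x m" using N assms(5) by simp
    finally show "ell_nth x m + ?G (N + 1) * ell_nth x N - ?G N * ell_nth x (N + 1)
      = (\<Sum>n=1..N. ?G n * ((k + 1 / k) * ell_nth x n - Jac a (ell_nth x) n))"
      using summation_by_parts[of ?G a N "k + 1 / k" "ell_nth x"] N assms green_boundary[OF assms(1-3,5)]
      by simp
  qed
  ultimately show ?thesis
    by (auto elim: Lim_transform_eventually)
qed

section \<open>The matrix condition and the form condition\<close>

text \<open>The weights are chosen such that \<open>\<Sum>k<n. stepweight a k\<close> is \<open>a/(1-a) + n\<close>. Hence \<open>K'\<close>
  factors as \<open>B\<^sup>* W B\<close> with \<open>W = diag (stepweight a)\<close> and \<open>B = Kfactor v\<close>, while \<open>energy\<close> is the form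
  of \<open>-\<Delta>\<^sub>a\<close> in terms of the increments of \<open>x\<close>, the increment at \<open>0\<close> being \<open>x 1\<close>.\<close>

definition stepweight :: "real \<Rightarrow> nat \<Rightarrow> real" where
  "stepweight a k = (if k = 0 then 1 / (1 - a) else 1)"

definition energy :: "real \<Rightarrow> nat \<Rightarrow> (nat \<Rightarrow> complex) \<Rightarrow> real" where
  "energy a P x = (\<Sum>k<P. (cmod (x (Suc k) - x k))\<^sup>2 / stepweight a k)"

text \<open>A discrete Hardy inequality on finite segments, the meeting point of the two hypotheses.
  No condition is imposed at the right end, so the increments of x are free.\<close>

definition hardy_bound :: "real \<Rightarrow> (nat \<Rightarrow> complex) \<Rightarrow> real \<Rightarrow> bool" where
  "hardy_bound a v c \<longleftrightarrow> (\<forall>P x. x 0 = 0 \<longrightarrow> (\<Sum>n=1..P. cmod (v n) * (cmod (x n))\<^sup>2) \<le> c * energy a P x)"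

definition Kfactor :: "(nat \<Rightarrow> complex) \<Rightarrow> nat \<Rightarrow> nat \<Rightarrow> real" where
  "Kfactor v k n = (if k < n then sqrt (cmod (v n)) else 0)"

text \<open>This is B y for y cut off to \<open>{1..P}\<close>; \<open>Kapp\<close> is K' applied to
  the same cut-off.\<close>

definition Kadj :: "(nat \<Rightarrow> complex) \<Rightarrow> nat \<Rightarrow> (nat \<Rightarrow> complex) \<Rightarrow> nat \<Rightarrow> complex" where
  "Kadj v P y k = (\<Sum>n=1..P. Kfactor v k n *\<^sub>R y n)"

definition Kapp :: "real \<Rightarrow> (nat \<Rightarrow> complex) \<Rightarrow> nat \<Rightarrow> (nat \<Rightarrow> complex) \<Rightarrow> nat \<Rightarrow> complex" where
  "Kapp a v P y m = (\<Sum>n=1..P. Kmat a v m n *\<^sub>R y n)"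

lemma stepweight_pos: "a < 1 \<Longrightarrow> stepweight a k > 0"
  by (simp add: stepweight_def)

lemma energy_nonneg: "a < 1 \<Longrightarrow> energy a P x \<ge> 0"
  unfolding energy_def by (intro sum_nonneg divide_nonneg_pos stepweight_pos) auto

lemma sum_stepweight:
  assumes "a < 1" and "n > 0"
  shows "(\<Sum>k<n. stepweight a k) = a / (1 - a) + real n"
proof -
  obtain p where n: "n = Suc p" using assms(2) gr0_implies_Suc by blast
  have "(\<Sum>k<n. stepweight a k) = 1 / (1 - a) + real p"
    by (simp add: n sum.lessThan_Suc_shift stepweight_def del: sum.lessThan_Suc)
  also have "\<dots> = a / (1 - a) + real n"
    using assms(1) by (simp add: n field_simps)
  finally show ?thesis .
qed

lemma sum_lessThan_if:
  fixes f :: "nat \<Rightarrow> 'a::comm_monoid_add"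
  assumes "m \<le> P"
  shows "(\<Sum>k<P. if k < m then f k else 0) = (\<Sum>k<m. f k)"
proof -
  have "{..<m} = {..<P} \<inter> {k. k < m}" using assms by auto
  then show ?thesis by (simp add: sum.inter_restrict)
qed

text \<open>Only k < min m n contributes, so cutting the sum off at P >= m, n loses nothing.\<close>

lemma Kmat_factorization:
  assumes "a < 1" and "m \<in> {1..P}" and "n \<in> {1..P}"
  shows "Kmat a v m n = (\<Sum>k<P. stepweight a k * Kfactor v k m * Kfactor v k n)"
proof -
  have "(\<Sum>k<P. stepweight a k * Kfactor v k m * Kfactor v k n)
      = (\<Sum>k<P. if k < min m n then stepweight a k * (sqrt (cmod (v m)) * sqrt (cmod (v n))) else 0)"
    by (rule sum.cong) (auto simp: Kfactor_def)
  also have "\<dots> = (\<Sum>k<min m n. stepweight a k) * (sqrt (cmod (v m)) * sqrt (cmod (v n)))"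
    using assms by (subst sum_lessThan_if) (auto simp: sum_distrib_right)
  also have "\<dots> = Kmat a v m n"
    using assms by (subst sum_stepweight) (auto simp: Kmat_def)
  finally show ?thesis by simp
qed

lemma Kapp_eq:
  assumes "a < 1" and "m \<in> {1..P}"
  shows "Kapp a v P y m = (\<Sum>k<P. (stepweight a k * Kfactor v k m) *\<^sub>R Kadj v P y k)"
proof -
  have "Kapp a v P y m = (\<Sum>n=1..P. \<Sum>k<P. (stepweight a k * Kfactor v k m * Kfactor v k n) *\<^sub>R y n)"
    unfolding Kapp_def
    by (rule sum.cong) (simp_all only: Kmat_factorization[OF assms] scaleR_sum_left)
  also have "\<dots> = (\<Sum>k<P. \<Sum>n=1..P. (stepweight a k * Kfactor v k m * Kfactor v k n) *\<^sub>R y n)"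
    by (rule sum.swap)
  finally show ?thesis by (simp add: Kadj_def scaleR_sum_right)
qed

lemma sum_inner_Kadj:
  "(\<Sum>k<P. e k \<bullet> Kadj v P y k) = (\<Sum>n=1..P. (\<Sum>k<P. Kfactor v k n *\<^sub>R e k) \<bullet> y n)"
  unfolding Kadj_def inner_sum_right inner_sum_left by (subst sum.swap) simp

lemma Kapp_quadratic_form:
  assumes "a < 1"
  shows "(\<Sum>k<P. stepweight a k * (cmod (Kadj v P y k))\<^sup>2) = (\<Sum>m=1..P. y m \<bullet> Kapp a v P y m)"
proof -
  have "(\<Sum>k<P. stepweight a k * (cmod (Kadj v P y k))\<^sup>2)
      = (\<Sum>k<P. (stepweight a k *\<^sub>R Kadj v P y k) \<bullet> Kadj v P y k)"
    by (simp add: power2_norm_eq_inner)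
  also have "\<dots> = (\<Sum>n=1..P. (\<Sum>k<P. Kfactor v k n *\<^sub>R stepweight a k *\<^sub>R Kadj v P y k) \<bullet> y n)"
    by (rule sum_inner_Kadj)
  also have "\<dots> = (\<Sum>m=1..P. y m \<bullet> Kapp a v P y m)"
    by (rule sum.cong) (use assms in \<open>simp_all add: Kapp_eq mult.commute inner_commute\<close>)
  finally show ?thesis .
qed

lemma sum_inner_power2_le:
  fixes f g :: "'i \<Rightarrow> 'a::real_inner"
  shows "(\<Sum>i\<in>I. f i \<bullet> g i)\<^sup>2 \<le> (\<Sum>i\<in>I. (norm (f i))\<^sup>2) * (\<Sum>i\<in>I. (norm (g i))\<^sup>2)"
proof -
  have "\<bar>\<Sum>i\<in>I. f i \<bullet> g i\<bar> \<le> (\<Sum>i\<in>I. norm (f i) * norm (g i))"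
    by (rule order_trans[OF sum_abs]) (intro sum_mono Cauchy_Schwarz_ineq2)
  then have "(\<Sum>i\<in>I. f i \<bullet> g i)\<^sup>2 \<le> (\<Sum>i\<in>I. norm (f i) * norm (g i))\<^sup>2"
    by (metis abs_ge_zero power2_abs power_mono)
  also have "\<dots> \<le> (\<Sum>i\<in>I. (norm (f i))\<^sup>2) * (\<Sum>i\<in>I. (norm (g i))\<^sup>2)"
    by (rule Cauchy_Schwarz_ineq_sum)
  finally show ?thesis .
qed

text \<open>Padding with zeros up to the larger of the two truncation lengths reduces the condition
  to square truncations.\<close>

lemma matrix_norm_le_iff_Kapp:
  "matrix_norm_le (Kmat a v) c \<longleftrightarrow>
     (\<forall>P y. (\<Sum>m=1..P. (cmod (Kapp a v P y m))\<^sup>2) \<le> c\<^sup>2 * (\<Sum>n=1..P. (cmod (y n))\<^sup>2))"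
proof (intro iffI allI)
  fix P y assume "matrix_norm_le (Kmat a v) c"
  then show "(\<Sum>m=1..P. (cmod (Kapp a v P y m))\<^sup>2) \<le> c\<^sup>2 * (\<Sum>n=1..P. (cmod (y n))\<^sup>2)"
    by (simp add: matrix_norm_le_def Kapp_def scaleR_conv_of_real)
next
  assume *: "\<forall>P y. (\<Sum>m=1..P. (cmod (Kapp a v P y m))\<^sup>2) \<le> c\<^sup>2 * (\<Sum>n=1..P. (cmod (y n))\<^sup>2)"
  show "matrix_norm_le (Kmat a v) c"
    unfolding matrix_norm_le_def
  proof (intro allI)
    fix N M :: nat and \<psi> :: "nat \<Rightarrow> complex"
    define P where "P = max M N"
    define y where "y n = (if n \<in> {1..N} then \<psi> n else 0)" for n
    have sub: "min P N = N" by (simp add: P_def)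
    have 1: "Kapp a v P y m = (\<Sum>n=1..N. of_real (Kmat a v m n) * \<psi> n)" for m
    proof -
      have "Kapp a v P y m = (\<Sum>n=1..P. if n \<in> {1..N} then of_real (Kmat a v m n) * \<psi> n else 0)"
        unfolding Kapp_def by (rule sum.cong) (auto simp: y_def scaleR_conv_of_real)
      then show ?thesis by (simp add: sum.inter_restrict[symmetric] sub del: atLeastAtMost_iff)
    qed
    have "(\<Sum>n=1..P. (cmod (y n))\<^sup>2) = (\<Sum>n=1..P. if n \<in> {1..N} then (cmod (\<psi> n))\<^sup>2 else 0)"
      by (rule sum.cong) (auto simp: y_def)
    then have 2: "(\<Sum>n=1..P. (cmod (y n))\<^sup>2) = (\<Sum>n=1..N. (cmod (\<psi> n))\<^sup>2)"
      by (simp add: sum.inter_restrict[symmetric] sub del: atLeastAtMost_iff)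
    have "(\<Sum>m=1..M. (cmod (Kapp a v P y m))\<^sup>2) \<le> (\<Sum>m=1..P. (cmod (Kapp a v P y m))\<^sup>2)"
      by (rule sum_mono2) (auto simp: P_def)
    also have "\<dots> \<le> c\<^sup>2 * (\<Sum>n=1..P. (cmod (y n))\<^sup>2)" using * by blast
    finally show "(\<Sum>m=1..M. (cmod (\<Sum>n=1..N. of_real (Kmat a v m n) * \<psi> n))\<^sup>2)
        \<le> c\<^sup>2 * (\<Sum>n=1..N. (cmod (\<psi> n))\<^sup>2)"
      by (simp only: 1 2)
  qed
qed

text \<open>Write T for W^(1/2) B. One side bounds T* T, the other bounds T* itself by the square
  root of c. In each direction Cauchy-Schwarz leads to a quadratic inequality from which one factor
  cancels.\<close>

lemma matrix_norm_le_iff_hardy_bound: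
  assumes "a < 1" and "0 \<le> c"
  shows "matrix_norm_le (Kmat a v) c \<longleftrightarrow> hardy_bound a v c"
proof
  assume K: "matrix_norm_le (Kmat a v) c"
  show "hardy_bound a v c"
    unfolding hardy_bound_def
  proof (intro allI impI)
    fix P and x :: "nat \<Rightarrow> complex" assume x0: "x 0 = 0"
    define y where "y n = sqrt (cmod (v n)) *\<^sub>R x n" for n
    define e where "e k = x (Suc k) - x k" for k
    define S where "S = (\<Sum>n=1..P. (cmod (y n))\<^sup>2)"
    define Q where "Q = (\<Sum>m=1..P. y m \<bullet> Kapp a v P y m)"
    have S0: "S \<ge> 0" by (simp add: S_def sum_nonneg)
    have E0: "energy a P x \<ge> 0" by (rule energy_nonneg[OF assms(1)])
    have "Q\<^sup>2 \<le> S * (\<Sum>m=1..P. (cmod (Kapp a v P y m))\<^sup>2)"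
      unfolding Q_def S_def by (rule sum_inner_power2_le)
    also have "\<dots> \<le> S * (c\<^sup>2 * S)"
      using K S0 by (intro mult_left_mono) (auto simp: matrix_norm_le_iff_Kapp S_def)
    also have "\<dots> = (c * S)\<^sup>2" by (simp add: power2_eq_square)
    finally have Q: "Q \<le> c * S"
      by (rule power2_le_imp_le) (use assms S0 in auto)
    \<comment> \<open>Since x 0 = 0, the increments telescope to x n, which gives y = B* e.\<close>
    have "S = (\<Sum>n=1..P. (\<Sum>k<P. Kfactor v k n *\<^sub>R e k) \<bullet> y n)"
      unfolding S_def
    proof (rule sum.cong)
      fix n assume n: "n \<in> {1..P}"
      have "(\<Sum>k<P. Kfactor v k n *\<^sub>R e k) = (\<Sum>k<P. if k < n then sqrt (cmod (v n)) *\<^sub>R e k else 0)"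
        by (rule sum.cong) (auto simp: Kfactor_def)
      also have "\<dots> = sqrt (cmod (v n)) *\<^sub>R (\<Sum>k<n. e k)"
        using n by (subst sum_lessThan_if) (auto simp: scaleR_sum_right)
      also have "\<dots> = y n"
        by (simp add: e_def sum_lessThan_telescope x0 y_def)
      finally show "(cmod (y n))\<^sup>2 = (\<Sum>k<P. Kfactor v k n *\<^sub>R e k) \<bullet> y n"
        by (simp add: power2_norm_eq_inner)
    qed simp
    also have "\<dots> = (\<Sum>k<P. e k \<bullet> Kadj v P y k)"
      by (rule sum_inner_Kadj[symmetric])
    \<comment> \<open>The weight is split so that Cauchy-Schwarz yields exactly
      \<open>energy a P x\<close> times Q.\<close>
    also have "\<dots> = (\<Sum>k<P. ((1 / sqrt (stepweight a k)) *\<^sub>R e k)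
        \<bullet> (sqrt (stepweight a k) *\<^sub>R Kadj v P y k))"
      using stepweight_pos[OF assms(1)] by (intro sum.cong) (auto simp: less_imp_neq[symmetric])
    finally have "S\<^sup>2 \<le> (\<Sum>k<P. (norm ((1 / sqrt (stepweight a k)) *\<^sub>R e k))\<^sup>2)
        * (\<Sum>k<P. (norm (sqrt (stepweight a k) *\<^sub>R Kadj v P y k))\<^sup>2)"
      using sum_inner_power2_le by metis
    also have "(\<Sum>k<P. (norm ((1 / sqrt (stepweight a k)) *\<^sub>R e k))\<^sup>2) = energy a P x"
      unfolding energy_def e_def using stepweight_pos[OF assms(1)]
      by (intro sum.cong) (auto simp: power_mult_distrib power_divide less_imp_le)
    also have "(\<Sum>k<P. (norm (sqrt (stepweight a k) *\<^sub>R Kadj v P y k))\<^sup>2)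
        = (\<Sum>k<P. stepweight a k * (cmod (Kadj v P y k))\<^sup>2)"
      using stepweight_pos[OF assms(1)]
      by (intro sum.cong) (auto simp: power_mult_distrib less_imp_le)
    also have "\<dots> = Q" unfolding Q_def by (rule Kapp_quadratic_form[OF assms(1)])
    also have "energy a P x * Q \<le> energy a P x * (c * S)"
      using Q E0 by (rule mult_left_mono)
    finally have "S * S \<le> (c * energy a P x) * S" by (simp add: power2_eq_square mult_ac)
    then have "S \<le> c * energy a P x"
      using S0 E0 assms(2) by (cases "S = 0") auto
    then show "(\<Sum>n=1..P. cmod (v n) * (cmod (x n))\<^sup>2) \<le> c * energy a P x"
      by (simp add: S_def y_def power_mult_distrib)
  qed
next
  assume H: "hardy_bound a v c"
  show "matrix_norm_le (Kmat a v) c"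
    unfolding matrix_norm_le_iff_Kapp
  proof (intro allI)
    fix P and y :: "nat \<Rightarrow> complex"
    define S where "S = (\<Sum>n=1..P. (cmod (y n))\<^sup>2)"
    define A where "A = (\<Sum>m=1..P. (cmod (Kapp a v P y m))\<^sup>2)"
    define Q where "Q = (\<Sum>m=1..P. y m \<bullet> Kapp a v P y m)"
    \<comment> \<open>The increments of this x are W B y. Hence |V|^(1/2) x = K' y on the segment,
      and the energy of x is the quadratic form Q.\<close>
    define x where "x m = (\<Sum>k<m. stepweight a k *\<^sub>R Kadj v P y k)" for m
    have S0: "S \<ge> 0" and A0: "A \<ge> 0" by (simp_all add: S_def A_def sum_nonneg)
    have "A = (\<Sum>n=1..P. cmod (v n) * (cmod (x n))\<^sup>2)"
      unfolding A_def
    proof (rule sum.cong)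
      fix m assume m: "m \<in> {1..P}"
      have "Kapp a v P y m = (\<Sum>k<P. if k < m then (sqrt (cmod (v m)) * stepweight a k) *\<^sub>R Kadj v P y k else 0)"
        unfolding Kapp_eq[OF assms(1) m] by (rule sum.cong) (auto simp: Kfactor_def)
      also have "\<dots> = sqrt (cmod (v m)) *\<^sub>R x m"
        using m by (subst sum_lessThan_if) (auto simp: x_def scaleR_sum_right)
      finally show "(cmod (Kapp a v P y m))\<^sup>2 = cmod (v m) * (cmod (x m))\<^sup>2"
        by (simp add: power_mult_distrib)
    qed simp
    also have "\<dots> \<le> c * energy a P x"
      using H[unfolded hardy_bound_def, rule_format, of x P] by (simp add: x_def)
    also have "energy a P x = (\<Sum>k<P. stepweight a k * (cmod (Kadj v P y k))\<^sup>2)"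
      unfolding energy_def
    proof (intro sum.cong refl)
      fix k
      have "x (Suc k) - x k = stepweight a k *\<^sub>R Kadj v P y k" by (simp add: x_def)
      then show "(cmod (x (Suc k) - x k))\<^sup>2 / stepweight a k = stepweight a k * (cmod (Kadj v P y k))\<^sup>2"
        using stepweight_pos[OF assms(1), of k] by (simp add: power_mult_distrib power2_eq_square)
    qed
    also have "\<dots> = Q" unfolding Q_def by (rule Kapp_quadratic_form[OF assms(1)])
    finally have "A\<^sup>2 \<le> (c * Q)\<^sup>2" using A0 by (intro power_mono)
    also have "\<dots> = c\<^sup>2 * Q\<^sup>2" by (simp add: power_mult_distrib)
    also have "\<dots> \<le> c\<^sup>2 * (S * A)"
      unfolding Q_def S_def A_def by (intro mult_left_mono sum_inner_power2_le) auto
    finally have "A * A \<le> (c\<^sup>2 * S) * A" by (simp add: power2_eq_square mult_ac)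
    then show "A \<le> c\<^sup>2 * S"
      using A0 S0 by (cases "A = 0") auto
  qed
qed

section \<open>The quadratic form of the discrete Laplacian\<close>

lemma negLap_form_eq:
  "negLap_form a (ell_nth x) = (norm (x - lshift x))\<^sup>2 + (1 - a) * (cmod (ell_nth x 1))\<^sup>2"
proof -
  let ?u = "2 *\<^sub>R x - jacobi (coef a (\<lambda>_. 0) 0) x"
  have J: "ell_nth (jacobi (coef a (\<lambda>_. 0) 0) x) n = Jac a (ell_nth x) n" for n
    by (subst ell_nth_jacobi) (simp_all add: shifted_def JV_def multop_def)
  have "summable (\<lambda>n. cnj (ell_nth x n) * ell_nth ?u n)"
    by (rule summable_norm_cancel)
       (simp only: norm_mult complex_mod_cnj l2_mult_summable[OF ell_nth_l2 ell_nth_l2])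
  then have "Re (\<Sum>n. cnj (ell_nth x n) * ell_nth ?u n) = (\<Sum>n. Re (cnj (ell_nth x n) * ell_nth ?u n))"
    by (rule bounded_linear.suminf[OF bounded_linear_Re])
  also have "\<dots> = x \<bullet> ?u"
    by (simp add: inner_ell_eq inner_complex_def)
  also have "\<dots> = 2 * (norm x)\<^sup>2 - jacobi (coef a (\<lambda>_. 0) 0) x \<bullet> x"
    by (simp add: inner_diff power2_norm_eq_inner inner_commute)
  finally show ?thesis
    by (simp add: negLap_form_def J two_minus_jacobi_form)
qed

lemma negLap_form_nonneg:
  assumes "a < 1" and "\<psi> \<in> l2"
  shows "negLap_form a \<psi> \<ge> 0"
proof -
  obtain x where "\<psi> = ell_nth x" using assms(2) Abs_ell_inverse by metis
  then show ?thesis using assms(1) by (simp add: negLap_form_eq)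
qed

text \<open>Up to sign, the increments after the first are the entries of
  \<open>x - lshift x\<close>. The first one, from 0 to x 1 with weight 1/(1-a), is the boundary
  term. The energy drops nonnegative terms beyond P.\<close>

lemma energy_le_negLap_form:
  "a < 1 \<Longrightarrow> energy a P (ell_nth x) \<le> negLap_form a (ell_nth x)"
proof (cases P)
  case (Suc p)
  assume a: "a < 1"
  have "energy a P (ell_nth x) = (1 - a) * (cmod (ell_nth x 1))\<^sup>2
      + (\<Sum>k<p. (cmod (ell_nth (x - lshift x) (Suc k)))\<^sup>2)"
    by (simp add: energy_def Suc sum.lessThan_Suc_shift stepweight_def ell_nth_lshift norm_minus_commute
        mult.commute del: sum.lessThan_Suc)
  moreover have "(\<Sum>k<p. (cmod (ell_nth (x - lshift x) (Suc k)))\<^sup>2)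
      = (\<Sum>k\<in>Suc ` {..<p}. (cmod (ell_nth (x - lshift x) k))\<^sup>2)"
    by (simp add: sum.reindex)
  moreover have "\<dots> \<le> (norm (x - lshift x))\<^sup>2"
    by (rule sum_le_norm_ell) simp
  ultimately show ?thesis
    unfolding negLap_form_eq by linarith
qed (use negLap_form_nonneg in \<open>auto simp: energy_def\<close>)

lemma form_bounded_if_hardy_bound:
  assumes "a < 1" and "0 \<le> c" and "hardy_bound a v c"
  shows "form_bounded a v c"
  unfolding form_bounded_def
proof (rule ballI)
  fix \<psi> assume "\<psi> \<in> l2"
  then obtain x where x: "\<psi> = ell_nth x" using Abs_ell_inverse by metis
  let ?f = "\<lambda>n. cmod (v n) * (cmod (\<psi> n))\<^sup>2"
  have bound: "(\<Sum>n<N. ?f n) \<le> c * negLap_form a \<psi>" for N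
  proof -
    have "(\<Sum>n<N. ?f n) \<le> (\<Sum>n\<in>{0..N}. ?f n)"
      by (rule sum_mono2) auto
    also have "\<dots> = (\<Sum>n=1..N. ?f n)"
      by (simp add: sum.atLeast_Suc_atMost x)
    also have "\<dots> \<le> c * energy a N \<psi>"
      using assms(3) by (simp add: hardy_bound_def x)
    also have "\<dots> \<le> c * negLap_form a \<psi>"
      unfolding x by (intro mult_left_mono energy_le_negLap_form assms)
    finally show ?thesis .
  qed
  have "summable ?f"
    by (rule summableI_nonneg_bounded[OF _ bound]) simp
  with bound show "summable ?f \<and> (\<Sum>n. ?f n) \<le> c * negLap_form a \<psi>"
    by (auto intro: suminf_le_const)
qed

text \<open>A sequence on \<open>{1..P}\<close> is continued to an element of \<open>l2\<close> by a linear ramp of length \<open>L\<close>; this costs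
  energy \<open>|x P|\<^sup>2 / L\<close>, which vanishes as \<open>L\<close> grows.\<close>

lemma hardy_bound_if_form_bounded:
  assumes "a < 1" and "0 \<le> c" and "form_bounded a v c"
  shows "hardy_bound a v c"
  unfolding hardy_bound_def
proof (intro allI impI)
  fix P and x :: "nat \<Rightarrow> complex" assume x0: "x 0 = 0"
  let ?f = "\<lambda>x n. cmod (v n) * (cmod (x n))\<^sup>2"
  show "(\<Sum>n=1..P. ?f x n) \<le> c * energy a P x"
  proof (cases "P = 0")
    case False
    have bound: "(\<Sum>n=1..P. ?f x n) \<le> c * (energy a P x + (cmod (x P))\<^sup>2 * inverse (real (Suc j)))" for j
    proof -
      define L where "L = Suc j"
      \<comment> \<open>The ramp falls linearly from 1 at P to 0 at P + L.\<close>
      define r where "r n = max 0 (1 - (real n - real P) / real L)" for n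
      define y where "y n = (if n < P then x n else of_real (r n) * x P)" for n
      have L: "L > 0" by (simp add: L_def)
      have rP: "r P = 1" by (simp add: r_def)
      have r0: "r n = 0" if "n \<ge> P + L" for n
      proof -
        have "real P + real L \<le> real n" using that by linarith
        then have "1 \<le> (real n - real P) / real L" using L by (simp add: field_simps)
        then show ?thesis by (simp add: r_def)
      qed
      have rd: "r n - r (Suc n) = 1 / real L" if "n < P + L" for n
      proof -
        have "real n + 1 \<le> real P + real L" using that by linarith
        then have "(real (Suc n) - real P) / real L \<le> 1" "(real n - real P) / real L \<le> 1"
          using L by (simp_all add: field_simps)
        then have "r n = 1 - (real n - real P) / real L" "r (Suc n) = 1 - (real (Suc n) - real P) / real L"
          by (simp_all add: r_def)
        then show ?thesis by (simp add: diff_divide_distrib add_divide_distrib)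
      qed
      have yx: "y n = x n" if "n \<le> P" for n
        using that rP by (auto simp: y_def)
      have yr: "y n = of_real (r n) * x P" if "n \<ge> P" for n
        using that by (simp add: y_def)
      have y0: "y n = 0" if "n \<ge> P + L" for n
        using that r0 by (simp add: y_def)
      have "summable (\<lambda>n. (cmod (y n))\<^sup>2)"
        by (rule summable_finite[of "{..<P+L}"]) (auto simp: y0)
      then have yl2: "y \<in> l2"
        using x0 yx[of 0] by (simp add: l2_def)
      define Y where "Y = Abs_ell y"
      have Y: "ell_nth Y = y" using yl2 by (simp add: Y_def Abs_ell_inverse)
      let ?d = "\<lambda>n. (cmod (ell_nth (Y - lshift Y) n))\<^sup>2"
      have d: "?d n = (cmod (y (Suc n) - y n))\<^sup>2" if "n \<ge> 1" for n
        using that by (simp add: Y ell_nth_lshift norm_minus_commute)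
      have "(norm (Y - lshift Y))\<^sup>2 = (\<Sum>n\<in>{1..<P+L}. ?d n)"
        unfolding norm_ell_power2
      proof (rule suminf_finite)
        fix n assume "n \<notin> {1..<P+L}"
        then have "n = 0 \<or> n \<ge> P + L" by auto
        then show "?d n = 0" using x0 yx[of 0] by (auto simp: Y ell_nth_lshift y0)
      qed simp
      also have "\<dots> = (\<Sum>n\<in>{1..<P}. ?d n) + (\<Sum>n\<in>{P..<P+L}. ?d n)"
        using False by (subst sum.atLeastLessThan_concat) auto
      also have "(\<Sum>n\<in>{1..<P}. ?d n) = (\<Sum>n\<in>{1..<P}. (cmod (x (Suc n) - x n))\<^sup>2 / stepweight a n)"
        by (intro sum.cong refl, subst d) (auto simp: yx stepweight_def)
      also have "(\<Sum>n\<in>{P..<P+L}. ?d n) = (\<Sum>n\<in>{P..<P+L}. (cmod (x P) / real L)\<^sup>2)"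
      proof (rule sum.cong)
        fix n assume n: "n \<in> {P..<P+L}"
        have "y n - y (Suc n) = of_real (r n - r (Suc n)) * x P"
          using n by (simp add: yr algebra_simps)
        also have "r n - r (Suc n) = 1 / real L" using n by (intro rd) simp
        finally have "cmod (y (Suc n) - y n) = cmod (x P) / real L"
          by (simp add: norm_minus_commute[of "y (Suc n)"] norm_mult norm_divide)
        then show "?d n = (cmod (x P) / real L)\<^sup>2"
          using n False by (subst d) auto
      qed simp
      also have "\<dots> = (cmod (x P))\<^sup>2 * inverse (real L)"
        using L by (simp add: power2_eq_square field_simps)
      finally have nY: "(norm (Y - lshift Y))\<^sup>2
        = (\<Sum>n\<in>{1..<P}. (cmod (x (Suc n) - x n))\<^sup>2 / stepweight a n) + (cmod (x P))\<^sup>2 * inverse (real L)" .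
      have "energy a P x = (cmod (x 1))\<^sup>2 * (1 - a) + (\<Sum>n\<in>{1..<P}. (cmod (x (Suc n) - x n))\<^sup>2 / stepweight a n)"
        using False unfolding energy_def lessThan_atLeast0
        by (subst sum.atLeast_Suc_lessThan) (auto simp: stepweight_def x0)
      then have q: "negLap_form a y = energy a P x + (cmod (x P))\<^sup>2 * inverse (real L)"
        using negLap_form_eq[of a Y] nY yx[of 1] False by (simp add: Y)
      have "summable (?f y)" and le: "(\<Sum>n. ?f y n) \<le> c * negLap_form a y"
        using assms(3) yl2 by (auto simp: form_bounded_def)
      have "(\<Sum>n=1..P. ?f x n) = (\<Sum>n=1..P. ?f y n)"
        by (rule sum.cong) (auto simp: yx)
      also have "\<dots> \<le> (\<Sum>n. ?f y n)"
        by (rule sum_le_suminf) (use \<open>summable (?f y)\<close> in auto)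
      also note le
      finally show ?thesis by (simp add: q L_def)
    qed
    have "(\<lambda>j. c * (energy a P x + (cmod (x P))\<^sup>2 * inverse (real (Suc j))))
        \<longlonglongrightarrow> c * (energy a P x + (cmod (x P))\<^sup>2 * 0)"
      by (intro tendsto_intros LIMSEQ_inverse_real_of_nat)
    then have "(\<Sum>n=1..P. ?f x n) \<le> c * (energy a P x + (cmod (x P))\<^sup>2 * 0)"
      by (rule LIMSEQ_le_const) (use bound in blast)
    then show ?thesis by simp
  qed (simp add: energy_def)
qed

lemma matrix_norm_lt1_iff_form_bounded:
  assumes "a < 1"
  shows "matrix_norm_lt1 (Kmat a v) \<longleftrightarrow> (\<exists>c<1. form_bounded a v c)"
proof
  assume "matrix_norm_lt1 (Kmat a v)"
  then show "\<exists>c<1. form_bounded a v c"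
    unfolding matrix_norm_lt1_def
    using matrix_norm_le_iff_hardy_bound[OF assms] form_bounded_if_hardy_bound[OF assms] by blast
next
  assume "\<exists>c<1. form_bounded a v c"
  then obtain c where c: "c < 1" "form_bounded a v c" by blast
  \<comment> \<open>The form condition admits a negative c, the matrix condition does not; since the
    form is nonnegative, c may be raised to 0.\<close>
  have "c * negLap_form a \<psi> \<le> max 0 c * negLap_form a \<psi>" if "\<psi> \<in> l2" for \<psi>
    by (intro mult_right_mono negLap_form_nonneg assms that) auto
  with c(2) have "form_bounded a v (max 0 c)"
    unfolding form_bounded_def by (meson order_trans)
  then have "matrix_norm_le (Kmat a v) (max 0 c)"
    using assms by (simp add: matrix_norm_le_iff_hardy_bound hardy_bound_if_form_bounded)
  then show "matrix_norm_lt1 (Kmat a v)"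
    using c(1) unfolding matrix_norm_lt1_def by (intro exI[of _ "max 0 c"]) auto
qed

section \<open>The perturbed operator\<close>

text \<open>Testing on the n-th unit vector bounds the diagonal entry of K', which is |v n| (a/(1-a)
  + n).\<close>

lemma Kmat_bound_imp_decay:
  assumes "0 \<le> a" "a < 1" and K: "matrix_norm_lt1 (Kmat a v)" and n: "n > 0"
  shows "cmod (v n) \<le> 1 / real n"
proof -
  obtain c where c: "0 \<le> c" "c < 1" "matrix_norm_le (Kmat a v) c"
    using K by (auto simp: matrix_norm_lt1_def)
  let ?\<psi> = "\<lambda>i. if i = n then 1 else 0 :: complex"
  have "(\<Sum>i=1..n. of_real (Kmat a v m i) * ?\<psi> i) = of_real (Kmat a v m n)" for m
    using n by (subst sum.remove[of _ n]) auto
  moreover have "(\<Sum>i=1..n. (cmod (?\<psi> i))\<^sup>2) = 1"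
    using n by (subst sum.remove[of _ n]) auto
  ultimately have "(\<Sum>m=1..n. (cmod (of_real (Kmat a v m n) :: complex))\<^sup>2) \<le> c\<^sup>2"
    using c(3)[unfolded matrix_norm_le_def, rule_format, where N = n and M = n and \<psi> = ?\<psi>] by simp
  moreover have "(Kmat a v n n)\<^sup>2 \<le> (\<Sum>m=1..n. (cmod (of_real (Kmat a v m n) :: complex))\<^sup>2)"
    using n member_le_sum[of n "{1..n}" "\<lambda>m. (Kmat a v m n)\<^sup>2"] by simp
  ultimately have "(Kmat a v n n)\<^sup>2 \<le> c\<^sup>2" by linarith
  then have K1: "Kmat a v n n \<le> 1"
    using c power2_le_imp_le by fastforce
  have "Kmat a v n n = (sqrt (cmod (v n)) * sqrt (cmod (v n))) * (a / (1 - a) + real n)"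
    unfolding Kmat_def by (simp only: min.idem mult_ac)
  then have "Kmat a v n n = cmod (v n) * (a / (1 - a)) + cmod (v n) * real n"
    by (simp add: algebra_simps)
  moreover have "cmod (v n) * (a / (1 - a)) \<ge> 0" using assms by simp
  ultimately have "cmod (v n) * real n \<le> 1" using K1 by linarith
  with n show ?thesis by (simp add: field_simps)
qed

lemma Kmat_bound_imp_bounded:
  assumes "0 \<le> a" "a < 1" and K: "matrix_norm_lt1 (Kmat a v)"
  shows "\<And>n. n > 0 \<Longrightarrow> cmod (v n) \<le> 1" and "bounded (range v)"
proof -
  show *: "cmod (v n) \<le> 1" if "n > 0" for n
  proof -
    have "cmod (v n) \<le> 1 / real n" by (rule Kmat_bound_imp_decay[OF assms that])
    also have "\<dots> \<le> 1" using that by simp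
    finally show ?thesis .
  qed
  \<comment> \<open>The hypothesis says nothing about the dummy entry v 0.\<close>
  have "cmod (v n) \<le> max 1 (cmod (v 0))" for n
    using *[of n] by (cases "n = 0") auto
  then show "bounded (range v)" by (auto simp: bounded_iff)
qed

section \<open>The Birman-Schwinger estimate and its consequences\<close>

definition sqrtabs :: "(nat \<Rightarrow> complex) \<Rightarrow> nat \<Rightarrow> complex" where
  "sqrtabs v n = of_real (sqrt (cmod (v n)))"

lemma bounded_sqrtabs:
  assumes "bounded (range v)"
  shows "bounded (range (sqrtabs v))"
proof -
  obtain B where "\<And>n. cmod (v n) \<le> B"
    using assms by (auto simp: bounded_iff)
  then show ?thesis
    by (auto simp: bounded_iff sqrtabs_def intro!: exI[of _ "sqrt B"])
qed

text \<open>The Birman--Schwinger estimate. Since the Green function is dominated entrywise by its value at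
  the edge \<open>z = 2\<close>, it holds for every spectral parameter, also inside \<open>[-2,2]\<close>.\<close>

lemma birman_schwinger_bound:
  assumes a: "0 \<le> a" "a < 1" and c: "0 \<le> c" and K: "matrix_norm_le (Kmat a v) c"
    and bv: "bounded (range v)"
    and eq: "jacobi (coef a (\<lambda>_. 0) z) x + mulop v y = 0"
  shows "norm (mulop (sqrtabs v) x) \<le> c * norm (mulop (sqrtabs v) y)"
proof -
  note bs = bounded_sqrtabs[OF bv]
  obtain k where k: "k \<noteq> 0" "cmod k \<le> 1" "z = k + 1 / k"
    using joukowski_exists by blast
  have eq_n: "z * ell_nth x n - Jac a (ell_nth x) n = v n * ell_nth y n" if "n > 0" for n
  proof -
    have "ell_nth (jacobi (coef a (\<lambda>_. 0) z) x) n + v n * ell_nth y n = 0"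
      using arg_cong[OF eq, of "\<lambda>x. ell_nth x n"] by (simp add: ell_nth_mulop bv)
    then have "Jac a (ell_nth x) n - z * ell_nth x n + v n * ell_nth y n = 0"
      using that by (simp add: ell_nth_jacobi shifted_def JV_def multop_def)
    then show ?thesis by algebra
  qed
  define s where "s n = sqrt (cmod (v n))" for n
  define f where "f n = s n * cmod (ell_nth y n)" for n
  \<comment> \<open>The hypothesis reads (z - J_a) x = V y, so these are partial sums of |V|^(1/2) G
    V y at m, with limit |V|^(1/2) x at m.\<close>
  define F where "F N m = of_real (s m) * (\<Sum>n=1..N. green a k m n * (v n * ell_nth y n))" for N m
  have s0: "s n \<ge> 0" and ss: "s n * s n = cmod (v n)" for n by (simp_all add: s_def)
  have F: "(\<lambda>N. F N m) \<longlonglongrightarrow> of_real (s m) * ell_nth x m" if "m > 0" for m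
  proof -
    have "(\<Sum>n=1..N. green a k m n * (v n * ell_nth y n))
        = (\<Sum>n=1..N. green a k m n * ((k + 1 / k) * ell_nth x n - Jac a (ell_nth x) n))" for N
      by (rule sum.cong) (use eq_n in \<open>auto simp: k(3)\<close>)
    then show ?thesis
      unfolding F_def using green_representation[OF a k(2,1) that, of x]
      by (intro tendsto_intros) simp
  qed
  \<comment> \<open>Of the two roots in |v n| = s n * s n, one completes the matrix entry of K' and
    the other goes into f.\<close>
  have Fle: "cmod (F N m) \<le> (\<Sum>n=1..N. Kmat a v m n * f n)" for N m
  proof -
    have "cmod (F N m) \<le> s m * (\<Sum>n=1..N. cmod (green a k m n * (v n * ell_nth y n)))"
      unfolding F_def norm_mult[of "of_real (s m)"] using s0[of m]
      by (auto intro!: mult_left_mono norm_sum)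
    also have "\<dots> \<le> s m * (\<Sum>n=1..N. (a / (1 - a) + real (min m n)) * (s n * f n))"
    proof (intro mult_left_mono sum_mono s0)
      fix n
      have "cmod (green a k m n * (v n * ell_nth y n)) = cmod (green a k m n) * (s n * f n)"
        by (simp add: norm_mult f_def mult.assoc flip: ss)
      also have "\<dots> \<le> (a / (1 - a) + real (min m n)) * (s n * f n)"
        by (intro mult_right_mono green_bound[OF a k(2)]) (simp add: f_def s0)
      finally show "cmod (green a k m n * (v n * ell_nth y n)) \<le> \<dots>" .
    qed
    also have "\<dots> = (\<Sum>n=1..N. Kmat a v m n * f n)"
      by (simp add: sum_distrib_left Kmat_def s_def mult_ac)
    finally show ?thesis .
  qed
  show ?thesis
  proof (rule norm_ell_leI')
    show "0 \<le> c * norm (mulop (sqrtabs v) y)" using c by simp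
    fix M
    show "(\<Sum>m=1..M. (cmod (ell_nth (mulop (sqrtabs v) x) m))\<^sup>2) \<le> (c * norm (mulop (sqrtabs v) y))\<^sup>2"
    \<comment> \<open>M stays fixed while N tends to infinity; the independent truncations in
      \<open>matrix_norm_le\<close> provide a bound uniform in N.\<close>
    proof (rule LIMSEQ_le_const2)
      have "(\<lambda>N. \<Sum>m=1..M. (cmod (F N m))\<^sup>2) \<longlonglongrightarrow> (\<Sum>m=1..M. (cmod (of_real (s m) * ell_nth x m))\<^sup>2)"
        by (intro tendsto_sum tendsto_power tendsto_norm F) auto
      then show "(\<lambda>N. \<Sum>m=1..M. (cmod (F N m))\<^sup>2)
          \<longlonglongrightarrow> (\<Sum>m=1..M. (cmod (ell_nth (mulop (sqrtabs v) x) m))\<^sup>2)"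
        by (simp add: ell_nth_mulop[OF bs] sqrtabs_def s_def)
      have "(\<Sum>m=1..M. (cmod (F N m))\<^sup>2) \<le> (c * norm (mulop (sqrtabs v) y))\<^sup>2" for N
      proof -
        have "(\<Sum>m=1..M. (cmod (F N m))\<^sup>2) \<le> (\<Sum>m=1..M. (\<Sum>n=1..N. Kmat a v m n * f n)\<^sup>2)"
          by (intro sum_mono power_mono Fle) auto
        also have "\<dots> = (\<Sum>m=1..M. (cmod (\<Sum>n=1..N. of_real (Kmat a v m n) * of_real (f n)))\<^sup>2)"
          by (simp flip: of_real_mult of_real_sum)
        also have "\<dots> \<le> c\<^sup>2 * (\<Sum>n=1..N. (cmod (of_real (f n) :: complex))\<^sup>2)"
          by (rule K[unfolded matrix_norm_le_def, rule_format])
        also have "(\<Sum>n=1..N. (cmod (of_real (f n) :: complex))\<^sup>2)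
            = (\<Sum>n\<in>{1..N}. (cmod (ell_nth (mulop (sqrtabs v) y) n))\<^sup>2)"
          by (simp add: ell_nth_mulop[OF bs] sqrtabs_def f_def s_def norm_mult power_mult_distrib)
        also have "c\<^sup>2 * \<dots> \<le> c\<^sup>2 * (norm (mulop (sqrtabs v) y))\<^sup>2"
          by (intro mult_left_mono sum_le_norm_ell) auto
        finally show ?thesis by (simp add: power_mult_distrib)
      qed
      then show "\<exists>N. \<forall>n\<ge>N. (\<Sum>m=1..M. (cmod (F n m))\<^sup>2) \<le> (c * norm (mulop (sqrtabs v) y))\<^sup>2"
        by blast
    qed
  qed
qed

text \<open>The estimate with y = x and c < 1 forces |V|^(1/2) x = 0, hence V x = 0. Then x lies in
  the kernel of J_a - z, and the Green representation makes it vanish.\<close>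

lemma jacobi_kernel_trivial:
  assumes a: "0 \<le> a" "a < 1" and K: "matrix_norm_lt1 (Kmat a v)"
    and x: "jacobi (coef a v z) x = 0"
  shows "x = 0"
proof -
  note bv = Kmat_bound_imp_bounded(2)[OF a K]
  note bs = bounded_sqrtabs[OF bv]
  obtain c where c: "0 \<le> c" "c < 1" "matrix_norm_le (Kmat a v) c"
    using K by (auto simp: matrix_norm_lt1_def)
  have eq: "jacobi (coef a (\<lambda>_. 0) z) x + mulop v x = 0"
    using x by (simp add: jacobi_coef_split[OF bv])
  have "norm (mulop (sqrtabs v) x) \<le> c * norm (mulop (sqrtabs v) x)"
    by (rule birman_schwinger_bound[OF a c(1,3) bv eq])
  then have "(1 - c) * norm (mulop (sqrtabs v) x) \<le> 0" by (simp add: algebra_simps)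
  then have "mulop (sqrtabs v) x = 0"
    using c(2) by (simp add: mult_le_0_iff)
  then have "sqrtabs v n * ell_nth x n = 0" for n
    using ell_nth_mulop[OF bs, of x n] by simp
  then have vx: "v n * ell_nth x n = 0" for n by (auto simp: sqrtabs_def)
  obtain k where k: "k \<noteq> 0" "cmod k \<le> 1" "z = k + 1 / k"
    using joukowski_exists by blast
  have "(k + 1 / k) * ell_nth x n - Jac a (ell_nth x) n = 0" if "n > 0" for n
    using arg_cong[OF x, of "\<lambda>x. ell_nth x n"] vx[of n] that
    by (simp add: ell_nth_jacobi[OF bv] shifted_def JV_def multop_def k(3))
  then have "(\<Sum>n=1..N. green a k m n * ((k + 1 / k) * ell_nth x n - Jac a (ell_nth x) n)) = 0" for N m
    by (intro sum.neutral) auto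
  then have "ell_nth x m = 0" if "m > 0" for m
    using green_representation[OF a k(2,1) that, of x] by (simp add: LIMSEQ_const_iff)
  then show ?thesis by (intro ell_eqI) simp
qed

lemma Kmat_cnj: "Kmat a (\<lambda>n. cnj (v n)) = Kmat a v"
  by (intro ext) (simp add: Kmat_def)

text \<open>The adjoint is J_a + cnj V - cnj z. As K' depends on |v| only, the adjoint has trivial
  kernel too.\<close>

lemma jacobi_dense_range:
  assumes a: "0 \<le> a" "a < 1" and K: "matrix_norm_lt1 (Kmat a v)"
  shows "closure (range (jacobi (coef a v z))) = UNIV"
proof (rule dense_range_if_adjoint_injective)
  note bc = bounded_coef[OF Kmat_bound_imp_bounded(2)[OF a K]]
  show "linear (jacobi (coef a v z))"
    using bounded_linear_jacobi[OF bc] by (rule bounded_linear.linear)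
  fix y assume "\<And>x. jacobi (coef a v z) x \<bullet> y = 0"
  then have "jacobi (coef a (\<lambda>n. cnj (v n)) (cnj z)) y = 0"
    by (simp add: inner_jacobi[OF bc] coef_cnj) (metis inner_eq_zero_iff)
  then show "y = 0"
    by (rule jacobi_kernel_trivial[OF a, rotated]) (simp add: Kmat_cnj K)
qed

text \<open>This makes the free operator the special case V = 0 of the results on J_a + V.\<close>

lemma matrix_norm_lt1_zero: "matrix_norm_lt1 (Kmat a (\<lambda>_. 0))"
  unfolding matrix_norm_lt1_def matrix_norm_le_def by (intro exI[of _ 0]) (simp add: Kmat_def)

text \<open>Let g = (J_a + V - z) x, solve (J_a - z) x0 = g and put \<eta> = x - x0. Then (J_a - z)
  \<eta> = - V x, so the estimate bounds |V|^(1/2) \<eta> by c |V|^(1/2) x in norm. Absorbing this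
  with c < 1 controls |V|^(1/2) x by x0, and then x by g.\<close>

lemma jacobi_bounded_below:
  assumes a: "0 \<le> a" "a < 1" and K: "matrix_norm_lt1 (Kmat a v)" and z: "z \<notin> of_real ` {-2..2}"
  shows "\<exists>\<delta>>0. \<forall>x. \<delta> * norm x \<le> norm (jacobi (coef a v z) x)"
proof -
  let ?T0 = "jacobi (coef a (\<lambda>_. 0) z)"
  note v1 = Kmat_bound_imp_bounded(1)[OF a K] and bv = Kmat_bound_imp_bounded(2)[OF a K]
  note bs = bounded_sqrtabs[OF bv]
  obtain c where c: "0 \<le> c" "c < 1" "matrix_norm_le (Kmat a v) c"
    using K by (auto simp: matrix_norm_lt1_def)
  obtain \<delta> where \<delta>: "\<delta> > 0" "\<And>x. \<delta> * norm x \<le> norm (?T0 x)"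
    using free_bounded_below[OF a z] by blast
  have bl0: "bounded_linear ?T0" by (simp add: bounded_linear_jacobi)
  have surj: "surj ?T0"
    using surj_if_bounded_below_dense[OF bl0 \<delta>] jacobi_dense_range[OF a matrix_norm_lt1_zero] by blast
  have main: "norm x \<le> (1 / \<delta> + 1 / (\<delta> * (1 - c) * \<delta>)) * norm (jacobi (coef a v z) x)" for x
  proof -
    define g where "g = jacobi (coef a v z) x"
    obtain x0 where x0: "?T0 x0 = g" using surjD[OF surj, of g] by auto
    define \<eta> where "\<eta> = x - x0"
    have g: "g = ?T0 x + mulop v x" by (simp add: g_def jacobi_coef_split[OF bv])
    have T\<eta>: "?T0 \<eta> = ?T0 x - ?T0 x0"
      by (simp add: \<eta>_def bounded_linear.linear[OF bl0] linear_diff)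
    then have eq: "?T0 \<eta> + mulop v x = 0" using x0 g by simp
    have "norm (mulop (sqrtabs v) \<eta>) \<le> c * norm (mulop (sqrtabs v) x)"
      by (rule birman_schwinger_bound[OF a c(1,3) bv eq])
    moreover have "mulop (sqrtabs v) x = mulop (sqrtabs v) x0 + mulop (sqrtabs v) \<eta>"
      by (rule ell_eqI) (simp add: ell_nth_mulop[OF bs] \<eta>_def algebra_simps)
    then have "norm (mulop (sqrtabs v) x) \<le> norm (mulop (sqrtabs v) x0) + norm (mulop (sqrtabs v) \<eta>)"
      using norm_triangle_ineq by simp
    moreover have "norm (mulop (sqrtabs v) x0) \<le> 1 * norm x0"
      by (rule norm_mulop_le[OF _ bs]) (use v1 in \<open>simp add: sqrtabs_def\<close>)
    ultimately have 1: "(1 - c) * norm (mulop (sqrtabs v) x) \<le> norm x0"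
      by (simp add: algebra_simps)
    \<comment> \<open>Since |v n| <= 1, taking the square root only increases the entries.\<close>
    have "norm (mulop v x) \<le> norm (mulop (sqrtabs v) x)"
    proof (rule norm_ell_mono)
      fix n :: nat assume "n > 0"
      then have "cmod (v n) \<le> sqrt (cmod (v n))"
        using v1[of n] by (simp add: real_le_rsqrt power2_eq_square mult_left_le)
      then show "cmod (ell_nth (mulop v x) n) \<le> cmod (ell_nth (mulop (sqrtabs v) x) n)"
        by (simp add: ell_nth_mulop[OF bs] ell_nth_mulop[OF bv] sqrtabs_def norm_mult mult_right_mono)
    qed
    moreover have "norm (?T0 \<eta>) = norm (mulop v x)"
      using eq by (simp add: add_eq_0_iff2)
    ultimately have 2: "\<delta> * norm \<eta> \<le> norm (mulop (sqrtabs v) x)"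
      using \<delta>(2)[of \<eta>] by linarith
    have 3: "norm x0 \<le> norm g / \<delta>"
      using \<delta>(2)[of x0] \<delta>(1) x0 by (simp add: field_simps)
    have "norm (mulop (sqrtabs v) x) \<le> norm g / \<delta> / (1 - c)"
      by (subst pos_le_divide_eq) (use order_trans[OF 1 3] c(2) in \<open>simp_all add: mult.commute\<close>)
    from order_trans[OF 2 this] have "norm \<eta> \<le> norm g / \<delta> / (1 - c) / \<delta>"
      by (subst pos_le_divide_eq) (use \<delta>(1) in \<open>simp_all add: mult.commute\<close>)
    moreover have "norm x \<le> norm x0 + norm \<eta>"
      using norm_triangle_ineq[of x0 \<eta>] by (simp add: \<eta>_def)
    ultimately have "norm x \<le> norm g / \<delta> + norm g / \<delta> / (1 - c) / \<delta>"
      using 3 by linarith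
    also have "\<dots> = (1 / \<delta> + 1 / (\<delta> * (1 - c) * \<delta>)) * norm g"
      by (simp add: distrib_right)
    finally show ?thesis by (simp add: g_def)
  qed
  let ?C = "1 / \<delta> + 1 / (\<delta> * (1 - c) * \<delta>)"
  have C: "?C > 0" using \<delta>(1) c(2) by (intro add_pos_pos) auto
  show ?thesis
  proof (intro exI conjI allI)
    show "1 / ?C > 0" using C by simp
    show "1 / ?C * norm x \<le> norm (jacobi (coef a v z) x)" for x
      using main[of x] C by (simp add: pos_divide_le_eq mult.commute)
  qed
qed

section \<open>Resolvent set and spectrum of the perturbed operator\<close>

lemma l2_eq_range: "l2 = range ell_nth"
  using type_definition.Rep_range[OF type_definition_ell] by simp

lemma JV_dom_eq:
  assumes "bounded (range v)"
  shows "JV_dom v = l2"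
proof -
  have "multop v \<psi> = (\<lambda>n. v n * \<psi> n)" if "\<psi> \<in> l2" for \<psi>
    using l2_zero_index[OF that] by (auto simp: multop_def)
  then show ?thesis
    using l2_mult_bounded[OF assms] by (auto simp: JV_dom_def)
qed

lemma in_resolvent_if_outside:
  assumes a: "0 \<le> a" "a < 1" and K: "matrix_norm_lt1 (Kmat a v)" and z: "z \<notin> of_real ` {-2..2}"
  shows "in_resolvent (JV_dom v) (JV a v) z"
proof -
  let ?T = "jacobi (coef a v z)"
  note bv = Kmat_bound_imp_bounded(2)[OF a K]
  obtain \<delta> where \<delta>: "\<delta> > 0" "\<And>x. \<delta> * norm x \<le> norm (?T x)"
    using jacobi_bounded_below[OF a K z] by blast
  have bl: "bounded_linear ?T" by (rule bounded_linear_jacobi[OF bounded_coef[OF bv]])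
  have surj: "surj ?T"
    by (rule surj_if_bounded_below_dense[OF bl \<delta> jacobi_dense_range[OF a K]])
  have "inj ?T"
    using linear_injective_0[OF bounded_linear.linear[OF bl]] jacobi_kernel_trivial[OF a K] by blast
  have bij: "bij_betw (shifted (JV a v) z) l2 l2"
    unfolding bij_betw_def
  proof
    show "inj_on (shifted (JV a v) z) l2"
      using \<open>inj ?T\<close> unfolding l2_eq_range inj_on_def
      by (auto simp: ell_nth_jacobi[OF bv, symmetric] ell_nth_inject)
    have "shifted (JV a v) z ` range ell_nth = ell_nth ` range ?T"
      by (simp add: image_image ell_nth_jacobi[OF bv])
    then show "shifted (JV a v) z ` l2 = l2"
      using surj by (simp add: l2_eq_range)
  qed
  moreover have "\<forall>\<psi>\<in>l2. l2norm \<psi> \<le> 1 / \<delta> * l2norm (shifted (JV a v) z \<psi>)"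
    using \<delta> unfolding l2_eq_range
    by (auto simp: ell_nth_jacobi[OF bv, symmetric] norm_ell_eq[symmetric] field_simps)
  ultimately show ?thesis
    unfolding in_resolvent_def JV_dom_eq[OF bv] by blast
qed

text \<open>Singular Weyl sequence: plane waves \<open>k^n\<close> cut off to the window \<open>{N+1..2N}\<close>, where \<open>v\<close> is small.\<close>

lemma not_in_resolvent_inside:
  assumes a: "0 \<le> a" "a < 1" and K: "matrix_norm_lt1 (Kmat a v)" and z: "z \<in> of_real ` {-2..2}"
  shows "\<not> in_resolvent (JV_dom v) (JV a v) z"
proof
  note bv = Kmat_bound_imp_bounded(2)[OF a K]
  assume "in_resolvent (JV_dom v) (JV a v) z"
  then obtain C where C: "\<And>\<psi>. \<psi> \<in> l2 \<Longrightarrow> l2norm \<psi> \<le> C * l2norm (shifted (JV a v) z \<psi>)"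
    unfolding in_resolvent_def JV_dom_eq[OF bv] by blast
  have C': "norm x \<le> C * norm (jacobi (coef a v z) x)" for x
    using C[of "ell_nth x"] by (simp add: norm_ell_eq ell_nth_jacobi[OF bv])
  obtain t where t: "z = of_real t" "\<bar>t\<bar> \<le> 2" using z by (auto simp: abs_le_iff)
  \<comment> \<open>The point on the unit circle with real part t/2, so that z = k + 1/k.\<close>
  define k where "k = Complex (t / 2) (sqrt (1 - (t / 2)\<^sup>2))"
  have "(t / 2)\<^sup>2 \<le> 1" using t(2) by (simp add: abs_square_le_1)
  then have k1: "cmod k = 1" by (simp add: k_def cmod_def)
  then have kk: "k * cnj k = 1" by (simp add: complex_norm_square[symmetric])
  have "k + cnj k = z" by (simp add: k_def t complex_eq_iff)
  then have zk: "z * k = k * k + 1" using kk by (simp add: distrib_left mult.commute flip: \<open>k + cnj k = z\<close>)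
  have wave: "k ^ Suc (Suc n) + k ^ n = z * k ^ Suc n" for n
  proof -
    have "z * k ^ Suc n = (z * k) * k ^ n" by simp
    then show ?thesis unfolding zk by (simp add: algebra_simps)
  qed
  have z2: "cmod z \<le> 2" using t by simp
  \<comment> \<open>The constant C carries no sign, hence its absolute value. The factor 11 is 10
    from the two ends of the window plus 1 from V, independent of N, while the wave itself has norm
    \<open>sqrt N\<close>.\<close>
  have sqrt_le: "sqrt (real N) \<le> \<bar>C\<bar> * 11" if N: "N \<ge> 1" for N
  proof -
    define y where "y n = (if N < n \<and> n \<le> 2 * N then k ^ n else 0)" for n
    have ysupp: "y n = 0" if "n \<notin> {N<..2*N}" for n using that by (auto simp: y_def)
    have ysq: "(cmod (y n))\<^sup>2 = (if n \<in> {N<..2*N} then 1 else 0)" for n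
      by (auto simp: y_def norm_power k1)
    have y1: "cmod (y n) \<le> 1" for n
      by (auto simp: y_def norm_power k1)
    have "y \<in> l2"
      unfolding l2_def using ysupp by (auto intro!: summable_finite[of "{N<..2*N}"] simp: y_def)
    define x where "x = Abs_ell y"
    have x: "ell_nth x = y" using \<open>y \<in> l2\<close> by (simp add: x_def Abs_ell_inverse)
    have "(norm x)\<^sup>2 = (\<Sum>n\<in>{N<..2*N}. (cmod (y n))\<^sup>2)"
      unfolding norm_ell_power2 x by (rule suminf_finite) (auto simp: ysupp)
    also have "\<dots> = real N" by (simp add: ysq)
    finally have "(norm x)\<^sup>2 = real N" .
    then have nx: "norm x = sqrt (real N)" by (simp add: real_sqrt_unique)
    have "norm (mulop v x) \<le> 1"
    proof (rule power2_le_imp_le)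
      \<comment> \<open>There are N sites, and on each the decay of v bounds the entry by
        1/N.\<close>
      have "(norm (mulop v x))\<^sup>2 = (\<Sum>n\<in>{N<..2*N}. (cmod (v n * y n))\<^sup>2)"
        unfolding norm_ell_power2 ell_nth_mulop[OF bv] x by (rule suminf_finite) (auto simp: ysupp)
      also have "\<dots> \<le> (\<Sum>n\<in>{N<..2*N}. (1 / real N)\<^sup>2)"
      proof (intro sum_mono power_mono)
        fix n assume n: "n \<in> {N<..2*N}"
        have "cmod (v n * y n) \<le> cmod (v n)"
          using y1[of n] by (simp add: norm_mult mult_left_le)
        also have "\<dots> \<le> 1 / real n"
          by (rule Kmat_bound_imp_decay[OF a K]) (use n in auto)
        also have "\<dots> \<le> 1 / real N" using n N by (intro divide_left_mono) auto
        finally show "cmod (v n * y n) \<le> 1 / real N" .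
      qed auto
      also have "\<dots> = 1 / real N" using N by (simp add: power2_eq_square)
      also have "\<dots> \<le> 1\<^sup>2" using N by simp
      finally show "(norm (mulop v x))\<^sup>2 \<le> 1\<^sup>2" .
    qed simp
    moreover have "norm (jacobi (coef a (\<lambda>_. 0) z) x) \<le> 10"
    proof (rule power2_le_imp_le)
      let ?h = "\<lambda>n. ell_nth (jacobi (coef a (\<lambda>_. 0) z) x) n"
      let ?F = "{N, N + 1, 2 * N, 2 * N + 1}"
      have h: "?h n = Jac a y n - z * y n" for n
        by (subst ell_nth_jacobi) (simp_all add: shifted_def JV_def multop_def x)
      \<comment> \<open>Away from the four edge sites, either y vanishes at n and at its neighbours,
        or all three sites lie in the window and the plane wave solves the recurrence.\<close>
      have hz: "?h n = 0" if nF: "n \<notin> ?F" for n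
      proof -
        have "n \<noteq> N" "n \<noteq> N + 1" "n \<noteq> 2 * N" "n \<noteq> 2 * N + 1" using nF by auto
        then consider "n < N" | "n > 2 * N + 1" | "n > N + 1" "n < 2 * N" by linarith
        then show ?thesis
        proof cases
          case 3
          then obtain p where p: "n = Suc p" "p > N" by (cases n) auto
          then have "y (n - 1) = k ^ p" "y (n + 1) = k ^ Suc (Suc p)" "y n = k ^ Suc p"
            using 3 by (auto simp: y_def)
          then show ?thesis
            using wave[of p] p N unfolding h Jac_def by (simp add: add.commute)
        qed (auto simp: h Jac_def y_def)
      qed
      have hb: "cmod (?h n) \<le> 5" for n
      proof -
        have a1: "cmod (of_real a * y 1) \<le> 1"
          using a y1[of 1] by (simp add: norm_mult mult_le_one)
        have "cmod (Jac a y n) \<le> 2"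
          unfolding Jac_def using a1 y1[of 2] y1[of "n - 1"] y1[of "n + 1"]
          by (auto intro!: norm_triangle_le)
        moreover have "cmod (z * y n) \<le> 2 * 1"
          unfolding norm_mult by (intro mult_mono z2 y1) auto
        ultimately show ?thesis
          unfolding h using norm_triangle_ineq4[of "Jac a y n" "z * y n"] by linarith
      qed
      have "(norm (jacobi (coef a (\<lambda>_. 0) z) x))\<^sup>2 = (\<Sum>n\<in>?F. (cmod (?h n))\<^sup>2)"
        unfolding norm_ell_power2 by (rule suminf_finite) (use hz in auto)
      also have "\<dots> \<le> (\<Sum>n\<in>?F. 5\<^sup>2)"
        by (intro sum_mono power_mono hb) auto
      also have "\<dots> = real (card ?F) * 25" by simp
      \<comment> \<open>Only an upper bound: for N = 1 the sites N + 1 and 2 * N coincide.\<close>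
      also have "\<dots> \<le> 4 * 25"
        by (intro mult_right_mono) (auto simp: card_insert_if)
      finally show "(norm (jacobi (coef a (\<lambda>_. 0) z) x))\<^sup>2 \<le> 10\<^sup>2" by simp
    qed simp
    ultimately have T: "norm (jacobi (coef a v z) x) \<le> 11"
      unfolding jacobi_coef_split[OF bv]
      using norm_triangle_ineq[of "jacobi (coef a (\<lambda>_. 0) z) x" "mulop v x"] by linarith
    have "sqrt (real N) \<le> \<bar>C\<bar> * norm (jacobi (coef a v z) x)"
      using C'[of x] abs_ge_self[of C] mult_right_mono[OF abs_ge_self[of C] norm_ge_zero]
      unfolding nx by (meson order_trans)
    also have "\<dots> \<le> \<bar>C\<bar> * 11" using T by (intro mult_left_mono) auto
    finally show ?thesis .
  qed
  obtain N :: nat where N: "real N > (\<bar>C\<bar> * 11)\<^sup>2" using reals_Archimedean2 by blast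
  then have "N \<ge> 1" using zero_le_power2[of "\<bar>C\<bar> * 11"] by (cases N) auto
  from sqrt_le[OF this] have "real N \<le> (\<bar>C\<bar> * 11)\<^sup>2"
    using sqrt_le_D by blast
  with N show False by simp
qed

text \<open>Injectivity and dense range hold at every z, so each point of the spectrum belongs to
  the continuous spectrum.\<close>

lemma spectrum_eq_interval:
  assumes a: "0 \<le> a" "a < 1" and K: "matrix_norm_lt1 (Kmat a v)"
  shows "op_spectrum (JV_dom v) (JV a v) = of_real ` {-2..2}"
    and "op_cspectrum (JV_dom v) (JV a v) = of_real ` {-2..2}"
proof -
  note bv = Kmat_bound_imp_bounded(2)[OF a K]
  show s: "op_spectrum (JV_dom v) (JV a v) = of_real ` {-2..2}"
    using in_resolvent_if_outside[OF a K] not_in_resolvent_inside[OF a K]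
    by (auto simp: op_spectrum_def)
  have inj: "inj_on (shifted (JV a v) z) l2" for z
  proof -
    have "linear (jacobi (coef a v z))"
      by (rule bounded_linear.linear[OF bounded_linear_jacobi[OF bounded_coef[OF bv]]])
    then have "inj (jacobi (coef a v z))"
      using linear_injective_0 jacobi_kernel_trivial[OF a K] by blast
    then show ?thesis
      unfolding l2_eq_range inj_on_def
      by (auto simp: ell_nth_jacobi[OF bv, symmetric] ell_nth_inject)
  qed
  have dense: "\<exists>\<psi>\<in>l2. l2norm (\<lambda>n. shifted (JV a v) z \<psi> n - \<phi> n) < \<epsilon>"
    if \<phi>: "\<phi> \<in> l2" and "\<epsilon> > 0" for \<phi> \<epsilon> z
  proof -
    obtain y where y: "\<phi> = ell_nth y" using \<phi> unfolding l2_eq_range by blast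
    have "y \<in> closure (range (jacobi (coef a v z)))"
      using jacobi_dense_range[OF a K] by simp
    then obtain x where "dist (jacobi (coef a v z) x) y < \<epsilon>"
      using \<open>\<epsilon> > 0\<close> by (metis closure_approachable rangeE)
    moreover have "ell_nth (jacobi (coef a v z) x - y) = (\<lambda>n. shifted (JV a v) z (ell_nth x) n - \<phi> n)"
      by (simp add: fun_eq_iff y ell_nth_jacobi[OF bv])
    ultimately show ?thesis
      by (intro bexI[of _ "ell_nth x"]) (simp_all add: dist_norm norm_ell_eq)
  qed
  show "op_cspectrum (JV_dom v) (JV a v) = of_real ` {-2..2}"
    unfolding op_cspectrum_def s using inj dense by (auto simp: JV_dom_eq[OF bv])
qed

lemma free_spectrum:
  assumes "0 \<le> a" "a < 1"
  shows "op_spectrum l2 (Jac a) = of_real ` {-2..2}"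
proof -
  have "JV a (\<lambda>_. 0) = Jac a" "JV_dom (\<lambda>_. 0) = l2"
    by (auto simp: fun_eq_iff JV_def multop_def JV_dom_eq)
  then show ?thesis
    using spectrum_eq_interval(1)[OF assms matrix_norm_lt1_zero] by simp
qed

theorem theorem5p2:
  fixes a :: real and v :: "nat \<Rightarrow> complex"
  assumes "0 \<le> a" and "a < 1"
  shows "(matrix_norm_lt1 (Kmat a v) \<longleftrightarrow> (\<exists>c<1. form_bounded a v c))
    \<and> (matrix_norm_lt1 (Kmat a v) \<longrightarrow>
         op_spectrum (JV_dom v) (JV a v) = op_spectrum l2 (Jac a) \<and>
         op_cspectrum (JV_dom v) (JV a v) = op_spectrum l2 (Jac a))
    \<and> ((\<exists>c<1. form_bounded a v c) \<longrightarrow>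
         op_spectrum (JV_dom v) (JV a v) = op_spectrum l2 (Jac a) \<and>
         op_cspectrum (JV_dom v) (JV a v) = op_spectrum l2 (Jac a))"
  using matrix_norm_lt1_iff_form_bounded[OF assms(2), of v] spectrum_eq_interval[OF assms, of v]
    free_spectrum[OF assms] by simp

end
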